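(* Let $\mathbf{k}$ be a field of characteristic $0$ and $B$ an affine $\mathbf{k}$-domain graded over $\mathbf{k}$ by a finitely generated abelian group $G$. (a) $\mathcal{X}(B) = \bigcup_{H \in \mathcal{M}(B)} \mathbb{T}_H(B)$. (b) If $B$ is normal then each element $H$ of $\mathcal{M}(B)$ satisfies $H \supseteq \bar{\mathbb{G}}(B)$.
   Context: Rings are commutative, associative and unital; "domain" means integral domain; a domain is normal if it is integrally closed in its field of fractions. An affine $\mathbf{k}$-domain is a domain that is a finitely generated $\mathbf{k}$-algebra. For an abelian group $G$ (written additively), a $G$-graded ring is a ring $B=\bigoplus_{i\in G}B_i$ with $B_iB_j\subseteq B_{i+j}$. A $\mathbf{k}$-algebra $B$ is graded over $\mathbf{k}$ by $G$ if it is $G$-graded and $\mathbf{k}\subseteq B_0$. For a $G$-graded domain $B$, $\mathbb{G}(B)$ is the subgroup of $G$ generated by $\{i\in G : B_i\neq 0\}$. For a subgroup $H$ of $G$, $B^{(H)}=\bigoplus_{i\in H}B_i$, an $H$-graded ring. $\mathbb{T}(B)$ is the set of subgroups $H$ of $G$ such that $\mathbb{G}(B)/(H\cap\mathbb{G}(B))$ is a torsion group, and for $H\in\mathbb{T}(B)$, $\mathbb{T}_H(B)=\{H'\in\mathbb{T}(B): H'\subseteq H\}$. Let $\mathrm{Spec}^1(B)$ be the set of all prime ideals of $B$ of height $1$ (not necessarily homogeneous). For $\mathfrak{p}\in\mathrm{Spec}(B)$, $\mathbb{M}(B,\mathfrak{p})=\{i\in G: B_i\nsubseteq\mathfrak{p}\}$,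 a submonoid of $\mathbb{G}(B)$, and $\overline{\mathbb{M}}(B,\mathfrak{p})$ is the subgroup it generates. Define $\bar{\mathbb{G}}(B)=\bigcap_{\mathfrak{p}\in\mathrm{Spec}^1(B)}\overline{\mathbb{M}}(B,\mathfrak{p})$ if $\mathrm{Spec}^1(B)\neq\emptyset$, and $\bar{\mathbb{G}}(B)=\mathbb{G}(B)$ if $\mathrm{Spec}^1(B)=\emptyset$. A derivation $D:B\to B$ is locally nilpotent if for each $b\in B$ there is $n>0$ with $D^n(b)=0$; it is homogeneous if there is $d$ in the grading group with $D(B_i)\subseteq B_{i+d}$ for all $i$. $\mathrm{HLND}(B)$ is the set of homogeneous locally nilpotent derivations of a graded ring $B$. $\mathcal{X}(B)=\{H\in\mathbb{T}(B):\mathrm{HLND}(B^{(H)})\neq\{0\}\}$, and $\mathcal{M}(B)$ is the set of maximal elements of the poset $(\mathcal{X}(B),\subseteq)$. *)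

theory Defs
  imports
    "HOL-Library.FuncSet"
    "HOL-Library.Extended_Nat"
    "HOL-Computational_Algebra.Computational_Algebra"
begin

text \<open>The subgroup generated by a set is the library's \<open>group_closure\<close>.\<close>

definition add_subgroup :: "'a::ab_group_add set \<Rightarrow> bool" where
  "add_subgroup H \<longleftrightarrow> 0 \<in> H \<and> (\<forall>x\<in>H. \<forall>y\<in>H. x + y \<in> H) \<and> (\<forall>x\<in>H. - x \<in> H)"

definition fg_group :: "'a::ab_group_add itself \<Rightarrow> bool" where
  "fg_group _ \<longleftrightarrow> (\<exists>S::'a set. finite S \<and> group_closure S = UNIV)"

text \<open>For a subgroup \<open>N\<close> of \<open>A\<close>: the quotient \<open>A/N\<close> is a torsion group, i.e.\ every coset
  \<open>x + N\<close> satisfies \<open>n (x + N) = N\<close> for some \<open>n > 0\<close>. The sum is the multiple \<open>n x\<close>.\<close>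

definition torsion_quotient :: "'a::ab_group_add set \<Rightarrow> 'a set \<Rightarrow> bool" where
  "torsion_quotient A N \<longleftrightarrow> (\<forall>x\<in>A. \<exists>n>0. (\<Sum>i<(n::nat). x) \<in> N)"

definition structure_map :: "('k::field \<Rightarrow> 'b::comm_ring_1) \<Rightarrow> bool" where
  "structure_map \<iota> \<longleftrightarrow> \<iota> 1 = 1 \<and> (\<forall>x y. \<iota> (x + y) = \<iota> x + \<iota> y) \<and> (\<forall>x y. \<iota> (x * y) = \<iota> x * \<iota> y)"

definition unital_subring :: "'b::comm_ring_1 set \<Rightarrow> bool" where
  "unital_subring A \<longleftrightarrow> add_subgroup A \<and> 1 \<in> A \<and> (\<forall>x\<in>A. \<forall>y\<in>A. x * y \<in> A)"

definition fg_algebra :: "('k::field \<Rightarrow> 'b::comm_ring_1) \<Rightarrow> bool" where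
  "fg_algebra \<iota> \<longleftrightarrow> (\<exists>S. finite S \<and> (\<lambda>A. unital_subring A \<and> range \<iota> \<subseteq> A) hull S = UNIV)"

definition affine_domain :: "('k::field \<Rightarrow> 'b::idom) \<Rightarrow> bool" where
  "affine_domain \<iota> \<longleftrightarrow> structure_map \<iota> \<and> fg_algebra \<iota>"

definition integral_over_domain :: "'b::idom fract \<Rightarrow> bool" where
  "integral_over_domain x \<longleftrightarrow> (\<exists>p::'b poly. lead_coeff p = 1 \<and> poly (map_poly to_fract p) x = 0)"

definition normal_domain :: "'b::idom itself \<Rightarrow> bool" where
  "normal_domain _ \<longleftrightarrow> (\<forall>x::'b fract. integral_over_domain x \<longrightarrow> x \<in> range to_fract)"

definition ring_ideal :: "'b::comm_ring_1 set \<Rightarrow> bool" where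
  "ring_ideal I \<longleftrightarrow> module.subspace (*) I"

definition prime_ideal :: "'b::comm_ring_1 set \<Rightarrow> bool" where
  "prime_ideal P \<longleftrightarrow> ring_ideal P \<and> P \<noteq> UNIV \<and> (\<forall>x y. x * y \<in> P \<longrightarrow> x \<in> P \<or> y \<in> P)"

definition height :: "'b::comm_ring_1 set \<Rightarrow> enat" where
  "height P = (SUP n \<in> {n. \<exists>C :: nat \<Rightarrow> 'b set.
     C n = P \<and> (\<forall>i\<le>n. prime_ideal (C i)) \<and> (\<forall>i<n. C i \<subset> C (Suc i))}. enat n)"

definition Spec1 :: "'b::comm_ring_1 set set" where
  "Spec1 = {P. prime_ideal P \<and> height P = 1}"

text \<open>The ring is the whole type \<open>'b\<close>, the grading group the whole type \<open>'g\<close>, and \<open>B i\<close> is the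
  homogeneous component of degree \<open>i\<close>. A function as below is a family of homogeneous components,
  almost all zero; every ring element is the sum of exactly one such family.\<close>

definition hom_family :: "('g \<Rightarrow> 'b::comm_ring_1 set) \<Rightarrow> ('g \<Rightarrow> 'b) \<Rightarrow> bool" where
  "hom_family B f \<longleftrightarrow> (\<forall>i. f i \<in> B i) \<and> finite {i. f i \<noteq> 0}"

definition graded_ring :: "('g::ab_group_add \<Rightarrow> 'b::comm_ring_1 set) \<Rightarrow> bool" where
  "graded_ring B \<longleftrightarrow>
     (\<forall>i. add_subgroup (B i)) \<and>
     (\<forall>b. \<exists>!f. hom_family B f \<and> b = (\<Sum>i | f i \<noteq> 0. f i)) \<and>
     (\<forall>i j. \<forall>x\<in>B i. \<forall>y\<in>B j. x * y \<in> B (i + j))"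

definition graded_over :: "('k::field \<Rightarrow> 'b::comm_ring_1) \<Rightarrow> ('g::ab_group_add \<Rightarrow> 'b set) \<Rightarrow> bool" where
  "graded_over \<iota> B \<longleftrightarrow> graded_ring B \<and> range \<iota> \<subseteq> B 0"

text \<open>\<open>part B H\<close> is \<open>B\<^sup>(\<^sup>H\<^sup>)\<close>, the sum of the \<open>B i\<close> with \<open>i \<in> H\<close>.\<close>

definition part :: "('g::ab_group_add \<Rightarrow> 'b::comm_ring_1 set) \<Rightarrow> 'g set \<Rightarrow> 'b set" where
  "part B H = {(\<Sum>i | f i \<noteq> 0. f i) | f. hom_family B f \<and> (\<forall>i. f i \<noteq> 0 \<longrightarrow> i \<in> H)}"

lemma part_UNIV: "graded_ring B \<Longrightarrow> part B UNIV = UNIV"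
  unfolding part_def graded_ring_def by blast

definition GG :: "('g::ab_group_add \<Rightarrow> 'b::idom set) \<Rightarrow> 'g set" where
  "GG B = group_closure {i. B i \<noteq> {0}}"

definition TT :: "('g::ab_group_add \<Rightarrow> 'b::idom set) \<Rightarrow> 'g set set" where
  "TT B = {H. add_subgroup H \<and> torsion_quotient (GG B) (H \<inter> GG B)}"

definition TT_below :: "('g::ab_group_add \<Rightarrow> 'b::idom set) \<Rightarrow> 'g set \<Rightarrow> 'g set set" where
  "TT_below B H = {H' \<in> TT B. H' \<subseteq> H}"

definition MM :: "('g::ab_group_add \<Rightarrow> 'b::idom set) \<Rightarrow> 'b set \<Rightarrow> 'g set" where
  "MM B P = {i. \<not> B i \<subseteq> P}"

definition GG_bar :: "('g::ab_group_add \<Rightarrow> 'b::idom set) \<Rightarrow> 'g set" where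
  "GG_bar B = (if (Spec1 :: 'b set set) \<noteq> {} then (\<Inter>P\<in>Spec1. group_closure (MM B P)) else GG B)"

text \<open>Maps on a subring \<open>A\<close> are taken in \<open>A \<rightarrow>\<^sub>E A\<close>, so that two of them are equal iff they
  agree on \<open>A\<close>.\<close>

definition derivation_on :: "'b::comm_ring_1 set \<Rightarrow> ('b \<Rightarrow> 'b) \<Rightarrow> bool" where
  "derivation_on A D \<longleftrightarrow> D \<in> A \<rightarrow>\<^sub>E A \<and>
     (\<forall>x\<in>A. \<forall>y\<in>A. D (x + y) = D x + D y) \<and>
     (\<forall>x\<in>A. \<forall>y\<in>A. D (x * y) = D x * y + x * D y)"

definition locally_nilpotent_on :: "'b::comm_ring_1 set \<Rightarrow> ('b \<Rightarrow> 'b) \<Rightarrow> bool" where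
  "locally_nilpotent_on A D \<longleftrightarrow> (\<forall>b\<in>A. \<exists>n>0. (D ^^ n) b = 0)"

text \<open>\<open>HLND B H\<close> belongs to \<open>B\<^sup>(\<^sup>H\<^sup>)\<close> as an \<open>H\<close>-graded ring; in particular the degree \<open>d\<close>
  lies in \<open>H\<close>.\<close>

definition HLND :: "('g::ab_group_add \<Rightarrow> 'b::comm_ring_1 set) \<Rightarrow> 'g set \<Rightarrow> ('b \<Rightarrow> 'b) set" where
  "HLND B H = {D. derivation_on (part B H) D \<and> locally_nilpotent_on (part B H) D \<and>
     (\<exists>d\<in>H. \<forall>i\<in>H. D ` B i \<subseteq> B (i + d))}"

definition XX :: "('g::ab_group_add \<Rightarrow> 'b::idom set) \<Rightarrow> 'g set set" where
  "XX B = {H \<in> TT B. HLND B H \<noteq> {\<lambda>x\<in>part B H. 0}}"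

definition maximal_XX :: "('g::ab_group_add \<Rightarrow> 'b::idom set) \<Rightarrow> 'g set set" where
  "maximal_XX B = {H \<in> XX B. \<forall>H'\<in>XX B. H \<subseteq> H' \<longrightarrow> H' = H}"

end

theory Submission
  imports Defs
begin

text \<open>
  Both parts transport a homogeneous locally nilpotent derivation \<open>D\<close> of \<open>B\<^sup>(\<^sup>H\<^sup>)\<close> to another
  subgroup \<open>H'\<close> by a formula on homogeneous elements. Downwards, one takes
  \<open>b \<mapsto> \<gamma> D b / x\<^bsup>e - 1\<^esup>\<close> for a homogeneous local slice \<open>x\<close> of \<open>D\<close>, a suitable exponent \<open>e\<close> and a
  suitable homogeneous \<open>\<gamma>\<close> in the kernel of \<open>D\<close>. Upwards, to \<open>H + GG_bar B\<close>, one takes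
  \<open>b \<mapsto> D (b\<^sup>n) / (n b\<^bsup>n - 1\<^esup>)\<close>, where \<open>n\<close> annihilates \<open>GG B\<close> modulo \<open>H\<close>; this fraction lies in the
  localization at every prime of height one, hence in the ring if that is normal. Local
  nilpotence follows as the degree function of \<open>D\<close>, applied to \<open>b\<close> and to \<open>b\<^sup>n\<close> respectively,
  decreases. Affineness is used only through the Noetherian property, and maximal elements of
  \<open>XX B\<close> exist because finitely generated abelian groups are Noetherian.
\<close>

text \<open>The degree \<open>d\<close> of a derivation \<open>D\<close> of B^(H) lies in
  \<open>H\<close> but perhaps not in \<open>H'\<close>, so \<open>D\<close> may fail to preserve
  B^(H') and its degree has to be corrected modulo \<open>H'\<close>. Kernel elements of degree -d
  modulo \<open>H'\<close> may not exist. However, for a local slice \<open>x\<close> with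
  \<open>a = D x\<close> the fraction a/x has degree \<open>d\<close>, so the degree of (a/x)^(e-1)
  D is e d, which a power of a kernel element can cancel. The price is a denominator; the minimality
  of \<open>e\<close> is what allows it to be cleared.

  Upwards, the Leibniz rule leaves no choice: n b^(n-1) times the value at \<open>b\<close> has to
  be D(b^n), and b^n lies in B^(H) for every homogeneous \<open>b\<close>. The obstacles are that
  the quotient must lie in the ring and that additivity cannot be seen from a formula in n-th
  powers. For both, \<open>b\<close> is multiplied by a homogeneous \<open>z\<close> that moves it
  into B^(H). The group \<open>GG_bar B\<close> is the natural bound here, since its elements are
  exactly those that, at every prime of height one, can be compensated by generators of degrees not
  contained in the prime.\<close>

lemma maximal_above:
  assumes X: "X \<in> S"
    and acc: "\<And>C. \<lbrakk>\<And>k::nat. C k \<in> S; \<And>k. C k \<subseteq> C (Suc k)\<rbrakk> \<Longrightarrow> \<exists>k. C (Suc k) = C k"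
  shows "\<exists>M\<in>S. X \<subseteq> M \<and> (\<forall>Y\<in>S. M \<subseteq> Y \<longrightarrow> Y = M)"
proof (rule ccontr)
  assume no: "\<not> ?thesis"
  have "\<exists>Y. (Y \<in> S \<and> X \<subseteq> Y) \<and> Z \<subset> Y" if Z: "Z \<in> S \<and> X \<subseteq> Z" for Z
  proof -
    have "\<not> (\<forall>Y\<in>S. Z \<subseteq> Y \<longrightarrow> Y = Z)"
      using no Z by metis
    then obtain Y where "Y \<in> S" "Z \<subseteq> Y" "Y \<noteq> Z"
      by metis
    then show ?thesis
      using Z by (intro exI[of _ Y]) auto
  qed
  then obtain C where "\<forall>k. (C k \<in> S \<and> X \<subseteq> C k) \<and> C k \<subset> C (Suc k)"
    using X dependent_nat_choice[of "\<lambda>k Z. Z \<in> S \<and> X \<subseteq> Z" "\<lambda>k Z Y. Z \<subset> Y"] by auto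
  then show False
    using acc[of C] by (metis psubset_imp_subset psubset_eq)
qed

section \<open>Chains of subgroups\<close>

definition nmul :: "nat \<Rightarrow> 'g::ab_group_add \<Rightarrow> 'g" where
  "nmul n x = (\<Sum>i<n. x)"

lemma nmul_0 [simp]: "nmul 0 x = 0"
  by (simp add: nmul_def)

lemma nmul_zero [simp]: "nmul n 0 = 0"
  by (simp add: nmul_def)

lemma nmul_Suc [simp]: "nmul (Suc n) x = x + nmul n x"
  by (simp add: nmul_def add.commute)

lemma nmul_add_left: "nmul (m + n) x = nmul m x + nmul n x"
  by (induction m) (simp_all add: algebra_simps)

lemma nmul_add_right: "nmul n (x + y) = nmul n x + nmul n y"
  by (simp add: nmul_def sum.distrib)

lemma nmul_minus: "nmul n (- x) = - nmul n x"
  by (simp add: nmul_def sum_negf)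

lemma nmul_mult: "nmul (m * n) x = nmul m (nmul n x)"
  by (induction m) (simp_all add: nmul_add_left)

lemma add_subgroup_zero: "add_subgroup H \<Longrightarrow> 0 \<in> H"
  and add_subgroup_add: "add_subgroup H \<Longrightarrow> x \<in> H \<Longrightarrow> y \<in> H \<Longrightarrow> x + y \<in> H"
  and add_subgroup_minus: "add_subgroup H \<Longrightarrow> x \<in> H \<Longrightarrow> - x \<in> H"
  by (simp_all add: add_subgroup_def)

lemma add_subgroup_diff: "add_subgroup H \<Longrightarrow> x \<in> H \<Longrightarrow> y \<in> H \<Longrightarrow> x - y \<in> H"
  using add_subgroup_add[of H x "- y"] add_subgroup_minus by auto

lemma add_subgroup_nmul: "add_subgroup H \<Longrightarrow> x \<in> H \<Longrightarrow> nmul n x \<in> H"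
  by (induction n) (simp_all add: add_subgroup_zero add_subgroup_add)

lemma add_subgroup_sum:
  "add_subgroup H \<Longrightarrow> (\<And>i. i \<in> I \<Longrightarrow> f i \<in> H) \<Longrightarrow> sum f I \<in> H"
  by (induction I rule: infinite_finite_induct) (auto simp: add_subgroup_zero add_subgroup_add)

lemma add_subgroup_group_closure: "add_subgroup (group_closure S)"
  by (simp add: add_subgroup_def group_closure_add)

definition acc_subgroups :: "'g::ab_group_add set \<Rightarrow> bool" where
  "acc_subgroups A \<longleftrightarrow> (\<forall>L. (\<forall>k::nat. add_subgroup (L k) \<and> L k \<subseteq> A \<and> L k \<subseteq> L (Suc k)) \<longrightarrow>
     (\<exists>n. \<forall>m\<ge>n. L m = L n))"

lemma subset_chain_le: "(\<And>k::nat. L k \<subseteq> L (Suc k)) \<Longrightarrow> m \<le> n \<Longrightarrow> L m \<subseteq> L n"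
  by (rule lift_Suc_mono_le)

text \<open>Once the least positive element \<open>e\<close> of the union has appeared, each later
  member is the set of multiples of \<open>e\<close>. Truncated subtraction suffices for this,
  because \<open>p mod e\<close> is \<open>p - p div e * e\<close>.\<close>

lemma nat_subtractive_chain_stabilizes:
  fixes K :: "nat \<Rightarrow> nat set"
  assumes zero: "\<And>k. 0 \<in> K k"
    and add: "\<And>k p q. p \<in> K k \<Longrightarrow> q \<in> K k \<Longrightarrow> p + q \<in> K k"
    and diff: "\<And>k p q. p \<in> K k \<Longrightarrow> q \<in> K k \<Longrightarrow> p - q \<in> K k"
    and chain: "\<And>k. K k \<subseteq> K (Suc k)"
  shows "\<exists>n. \<forall>m\<ge>n. K m = K n"
proof (cases "\<exists>e>0. e \<in> (\<Union>k. K k)")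
  case False
  then have "K m = {0}" for m
    using zero[of m] by (metis UNIV_I UN_I gr0I subsetI subset_singletonD empty_iff singletonI)
  then show ?thesis
    by auto
next
  case True
  define e where "e = (LEAST e. e > 0 \<and> e \<in> (\<Union>k. K k))"
  have e: "e > 0" "e \<in> (\<Union>k. K k)"
    using LeastI_ex[OF True] by (auto simp: e_def)
  have least: "e \<le> p" if "p > 0" "p \<in> K k" for p k
    unfolding e_def by (rule Least_le) (use that in auto)
  from e(2) obtain n where n: "e \<in> K n"
    by auto
  have mult: "q * e \<in> K k" if "e \<in> K k" for q k
    by (induction q) (auto intro: zero add that)
  have "K m = K n" if "n \<le> m" for m
  proof
    have sub: "K n \<subseteq> K m"
      using chain that by (rule subset_chain_le)
    show "K m \<subseteq> K n"
    proof
      fix p assume p: "p \<in> K m"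
      have "p - p div e * e \<in> K m"
        using p mult[of m] sub n by (intro diff) auto
      then have "p mod e \<in> K m"
        by (simp add: minus_div_mult_eq_mod)
      moreover have "p mod e < e"
        using e by simp
      ultimately have "p mod e = 0"
        using least[of "p mod e" m] by (metis gr0I not_less)
      then have "p = p div e * e"
        by auto
      then show "p \<in> K n"
        using mult[OF n] by metis
    qed
    show "K n \<subseteq> K m"
      by (rule sub)
  qed
  then show ?thesis
    by blast
qed

text \<open>Two chains control \<open>L\<close>: the intersections with the subgroup generated by
  \<open>T\<close>, and the sets of multiples of \<open>x\<close> that occur modulo that subgroup.
  Nested subgroups that agree in both respects are equal.\<close>

lemma acc_subgroups_insert:
  assumes acc: "acc_subgroups (group_closure T)"
  shows "acc_subgroups (group_closure (insert x T))"
  unfolding acc_subgroups_def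
proof (intro allI impI)
  define A where "A = group_closure T"
  have A: "add_subgroup A"
    unfolding A_def by (rule add_subgroup_group_closure)
  \<comment> \<open>Working up to sign keeps the coefficient of \<open>x\<close> a natural number,
    so that the second chain can consist of sets of naturals.\<close>
  have signed: "(\<exists>p. \<exists>a\<in>A. y = a + nmul p x) \<or> (\<exists>p. \<exists>a\<in>A. - y = a + nmul p x)"
    if "y \<in> group_closure (insert x T)" for y
  proof -
    have "\<exists>p q. \<exists>a\<in>A. y = a + nmul p x - nmul q x"
      using that
    proof induction
      case (base s)
      then consider "s = 0" | "s = x" | "s \<in> T" by auto
      then show ?case
      proof cases
        case 1
        then show ?thesis
          using add_subgroup_zero[OF A] by (intro exI[of _ 0] bexI[of _ 0]) auto
      next
        case 2
        then show ?thesis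
          using add_subgroup_zero[OF A] by (intro exI[of _ 1] exI[of _ 0] bexI[of _ 0]) auto
      next
        case 3
        then have "s \<in> A"
          unfolding A_def by (intro group_closure.base) auto
        then show ?thesis
          by (intro exI[of _ 0] bexI[of _ s]) auto
      qed
    next
      case (diff s t)
      then obtain p q a p' q' a' where
        *: "a \<in> A" "s = a + nmul p x - nmul q x" "a' \<in> A" "t = a' + nmul p' x - nmul q' x"
        by blast
      have "s - t = (a - a') + nmul (p + q') x - nmul (q + p') x"
        unfolding * by (simp add: nmul_add_left)
      then show ?case
        using add_subgroup_diff[OF A] * by blast
    qed
    then obtain p q a where y: "a \<in> A" "y = a + nmul p x - nmul q x"
      by blast
    show ?thesis
    proof (cases "q \<le> p")
      case True
      then have "nmul p x = nmul (p - q) x + nmul q x"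
        by (simp add: nmul_add_left[symmetric])
      then have "y = a + nmul (p - q) x"
        using y by simp
      then show ?thesis
        using y by blast
    next
      case False
      then have "nmul q x = nmul (q - p) x + nmul p x"
        by (simp add: nmul_add_left[symmetric])
      then have "- y = - a + nmul (q - p) x"
        using y by simp
      then show ?thesis
        using y add_subgroup_minus[OF A] by blast
    qed
  qed
  fix L :: "nat \<Rightarrow> 'a set"
  assume L: "\<forall>k. add_subgroup (L k) \<and> L k \<subseteq> group_closure (insert x T) \<and> L k \<subseteq> L (Suc k)"
  then have sub: "add_subgroup (L k)" for k
    by blast
  have LA: "\<exists>n. \<forall>m\<ge>n. L m \<inter> A = L n \<inter> A"
    using acc L A unfolding acc_subgroups_def A_def[symmetric]
    by (elim allE[of _ "\<lambda>k. L k \<inter> A"]) (auto simp: add_subgroup_def)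
  then obtain n1 where n1: "\<And>m. m \<ge> n1 \<Longrightarrow> L m \<inter> A = L n1 \<inter> A"
    by blast
  define K where "K k = {p. \<exists>a\<in>A. a + nmul p x \<in> L k}" for k
  have "\<exists>n. \<forall>m\<ge>n. K m = K n"
  proof (rule nat_subtractive_chain_stabilizes)
    show "0 \<in> K k" for k
      using add_subgroup_zero[OF A] add_subgroup_zero[OF sub] by (auto simp: K_def intro: bexI[of _ 0])
    show "K k \<subseteq> K (Suc k)" for k
      using L by (auto simp: K_def)
    show "p + q \<in> K k" if pq: "p \<in> K k" "q \<in> K k" for p q k
    proof -
      obtain a b where "a \<in> A" "b \<in> A" "a + nmul p x \<in> L k" "b + nmul q x \<in> L k"
        using pq by (auto simp: K_def)
      moreover from this have "(a + nmul p x) + (b + nmul q x) \<in> L k"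
        by (blast intro: add_subgroup_add[OF sub])
      ultimately show ?thesis
        unfolding K_def using add_subgroup_add[OF A]
        by (auto simp: nmul_add_left algebra_simps intro!: bexI[of _ "a + b"])
    qed
    show "p - q \<in> K k" if "p \<in> K k" "q \<in> K k" for p q k
    proof (cases "q \<le> p")
      case False
      then show ?thesis
        using \<open>0 \<in> K k\<close> by simp
    next
      case True
      obtain a b where ab: "a \<in> A" "b \<in> A" "a + nmul p x \<in> L k" "b + nmul q x \<in> L k"
        using \<open>p \<in> K k\<close> \<open>q \<in> K k\<close> by (auto simp: K_def)
      have "nmul p x = nmul (p - q) x + nmul q x"
        using True by (simp add: nmul_add_left[symmetric])
      then have "(a - b) + nmul (p - q) x = (a + nmul p x) - (b + nmul q x)"
        by (simp add: algebra_simps)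
      also have "\<dots> \<in> L k"
        using ab by (blast intro: add_subgroup_diff[OF sub])
      finally show ?thesis
        unfolding K_def using add_subgroup_diff[OF A] ab by blast
    qed
  qed
  then obtain n2 where n2: "\<And>m. m \<ge> n2 \<Longrightarrow> K m = K n2"
    by blast
  define n where "n = max n1 n2"
  have "L m = L n" if m: "m \<ge> n" for m
  proof
    show nm: "L n \<subseteq> L m"
      by (rule subset_chain_le) (use L m in auto)
    have LAeq: "L m \<inter> A = L n \<inter> A" and Keq: "K m = K n"
      using n1[of m] n1[of n] n2[of m] n2[of n] m by (auto simp: n_def)
    have pos: "y \<in> L n" if "y \<in> L m" "a \<in> A" "y = a + nmul p x" for y a p
    proof -
      have "p \<in> K n"
        using that Keq by (auto simp: K_def)
      then obtain b where b: "b \<in> A" "b + nmul p x \<in> L n"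
        by (auto simp: K_def)
      then have "y - (b + nmul p x) \<in> L m"
        using that nm by (intro add_subgroup_diff[OF sub]) auto
      moreover have "y - (b + nmul p x) = a - b"
        using that by simp
      ultimately have "a - b \<in> L n"
        using add_subgroup_diff[OF A \<open>a \<in> A\<close> \<open>b \<in> A\<close>] LAeq by auto
      then have "(a - b) + (b + nmul p x) \<in> L n"
        using b by (blast intro: add_subgroup_add[OF sub])
      then show ?thesis
        using that by simp
    qed
    show "L m \<subseteq> L n"
    proof
      fix y assume y: "y \<in> L m"
      then have "y \<in> group_closure (insert x T)"
        using L by blast
      then consider p a where "a \<in> A" "y = a + nmul p x" | p a where "a \<in> A" "- y = a + nmul p x"
        using signed by blast
      then show "y \<in> L n"
      proof cases
        case 1
        then show ?thesis using pos y by blast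
      next
        case 2
        then have "- y \<in> L n"
          using pos[of "- y"] add_subgroup_minus[OF sub y] by blast
        then show ?thesis
          using add_subgroup_minus[OF sub] by fastforce
      qed
    qed
  qed
  then show "\<exists>n. \<forall>m\<ge>n. L m = L n"
    by blast
qed

lemma acc_subgroups_fg:
  assumes "fg_group TYPE('g::ab_group_add)"
  shows "acc_subgroups (UNIV :: 'g set)"
proof -
  have "acc_subgroups (group_closure S)" if "finite S" for S :: "'g set"
    using that
  proof induction
    case empty
    have "L m = {0}" if "\<forall>k. add_subgroup (L k) \<and> L k \<subseteq> {0} \<and> L k \<subseteq> L (Suc k)"
      for m and L :: "nat \<Rightarrow> 'g set"
      using that add_subgroup_zero by blast
    then show ?case
      unfolding acc_subgroups_def group_closure_empty by metis
  next
    case (insert x F)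
    then show ?case
      by (intro acc_subgroups_insert)
  qed
  then show ?thesis
    using assms unfolding fg_group_def by metis
qed

text \<open>The elements that \<open>fact m\<close> sends into \<open>H\<close> form a chain of
  subgroups, increasing because factorials divide each other. It stabilizes, and every torsion order
  divides some later factorial.\<close>

lemma torsion_quotient_exponent:
  assumes fg: "fg_group TYPE('g::ab_group_add)"
    and H: "add_subgroup H" and tor: "torsion_quotient A (H \<inter> A)"
  shows "\<exists>n>0. \<forall>x\<in>A. nmul n x \<in> (H::'g set)"
proof -
  define L where "L m = {x. nmul (fact m) x \<in> H}" for m
  have "add_subgroup (L m)" for m
    using H by (auto simp: add_subgroup_def L_def nmul_add_right nmul_minus)
  moreover have "L m \<subseteq> L (Suc m)" for m
  proof
    fix x assume "x \<in> L m"
    then have "nmul (Suc m) (nmul (fact m) x) \<in> H"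
      using add_subgroup_nmul[OF H] by (simp add: L_def del: nmul_Suc)
    then show "x \<in> L (Suc m)"
      unfolding L_def mem_Collect_eq fact_Suc of_nat_id nmul_mult .
  qed
  ultimately obtain n where n: "\<And>m. m \<ge> n \<Longrightarrow> L m = L n"
    using acc_subgroups_fg[OF fg] unfolding acc_subgroups_def by (metis subset_UNIV)
  have "nmul (fact n) x \<in> H" if "x \<in> A" for x
  proof -
    obtain p where p: "p > 0" "nmul p x \<in> H"
      using tor \<open>x \<in> A\<close> by (auto simp: torsion_quotient_def nmul_def)
    define m where "m = max n p"
    have "p dvd fact m"
      using p by (intro dvd_fact) (auto simp: m_def)
    then obtain c where "fact m = c * p"
      by (metis dvd_def mult.commute)
    then have "x \<in> L m"
      using add_subgroup_nmul[OF H p(2), of c] by (simp add: L_def nmul_mult)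
    then show ?thesis
      using n[of m] by (auto simp: L_def m_def)
  qed
  then show ?thesis
    by (intro exI[of _ "fact n"]) auto
qed

section \<open>Noetherian rings\<close>

text \<open>For a subring \<open>A\<close> this is equivalent to all ideals of \<open>A\<close> being finitely generated.\<close>

definition noetherian_on :: "'a::comm_ring_1 set \<Rightarrow> bool" where
  "noetherian_on A \<longleftrightarrow> (\<forall>r. (\<forall>i::nat. r i \<in> A) \<longrightarrow>
     (\<exists>n c. (\<forall>i<n. c i \<in> A) \<and> r n = (\<Sum>i<n. c i * r i)))"

definition polys_over :: "'a::comm_ring_1 set \<Rightarrow> 'a poly set" where
  "polys_over A = {p. \<forall>i. coeff p i \<in> A}"

lemma unital_subringD:
  assumes "unital_subring A"
  shows "add_subgroup A" "1 \<in> A" "0 \<in> A" "\<And>x y. x \<in> A \<Longrightarrow> y \<in> A \<Longrightarrow> x + y \<in> A"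
    "\<And>x y. x \<in> A \<Longrightarrow> y \<in> A \<Longrightarrow> x - y \<in> A" "\<And>x y. x \<in> A \<Longrightarrow> y \<in> A \<Longrightarrow> x * y \<in> A"
    "\<And>x. x \<in> A \<Longrightarrow> - x \<in> A"
  using assms
  by (auto simp: unital_subring_def intro: add_subgroup_zero add_subgroup_add add_subgroup_diff
      add_subgroup_minus)

lemma unital_subring_polys_over:
  assumes "unital_subring A"
  shows "unital_subring (polys_over A)"
  using unital_subringD[OF assms] unfolding unital_subring_def
  by (auto simp: add_subgroup_def polys_over_def coeff_mult
      intro!: add_subgroup_sum)

lemma monom_polys_over: "unital_subring A \<Longrightarrow> c \<in> A \<Longrightarrow> monom c k \<in> polys_over A"
  by (auto simp: polys_over_def unital_subringD)

lemma noetherian_on_image: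
  assumes A: "noetherian_on A"
    and add: "\<And>x y. \<phi> (x + y) = \<phi> x + \<phi> y" and mult: "\<And>x y. \<phi> (x * y) = \<phi> x * \<phi> y"
  shows "noetherian_on (\<phi> ` A)"
  unfolding noetherian_on_def
proof (intro allI impI)
  fix r :: "nat \<Rightarrow> 'b" assume "\<forall>i. r i \<in> \<phi> ` A"
  then have "\<forall>i. \<exists>s. s \<in> A \<and> r i = \<phi> s" by auto
  then obtain s where s: "\<And>i. s i \<in> A" "\<And>i. r i = \<phi> (s i)"
    by metis
  have zero: "\<phi> 0 = 0"
    using add[of 0 0] by simp
  have sum: "\<phi> (sum g I) = (\<Sum>i\<in>I. \<phi> (g i))" for g and I :: "nat set"
    by (induction I rule: infinite_finite_induct) (auto simp: add zero)
  obtain n c where "\<forall>i<n. c i \<in> A" "s n = (\<Sum>i<n. c i * s i)"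
    using A s unfolding noetherian_on_def by metis
  then show "\<exists>n c. (\<forall>i<n. c i \<in> \<phi> ` A) \<and> r n = (\<Sum>i<n. c i * r i)"
    by (intro exI[of _ n] exI[of _ "\<lambda>i. \<phi> (c i)"]) (auto simp: s sum mult)
qed

text \<open>In a bad sequence \<open>r\<close>, choose \<open>f n\<close> of minimal degree among the
  elements of the ideal \<open>I\<close> generated by \<open>r\<close> that are not in the ideal of \<open>f 0, \<dots>, f (n - 1)\<close>;
  the leading coefficients of \<open>f\<close> form a bad sequence in \<open>A\<close>.\<close>

lemma noetherian_on_polys_over:
  assumes noeth: "noetherian_on A" and A: "unital_subring A"
  shows "noetherian_on (polys_over A)"
proof (rule ccontr)
  let ?R = "polys_over A"
  note subA = unital_subringD[OF A]
  note R = unital_subring_polys_over[OF A]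
  note subR = unital_subringD[OF R]
  define gen :: "(nat \<Rightarrow> 'a poly) \<Rightarrow> nat \<Rightarrow> 'a poly set" where
    "gen f n = {\<Sum>i<n. c i * f i | c. \<forall>i<n. c i \<in> ?R}" for f n
  have genI: "(\<Sum>i<n. c i * f i) \<in> gen f n" if "\<forall>i<n. c i \<in> ?R" for c f n
    using that by (auto simp: gen_def)
  have gen_add: "p + q \<in> gen f n" if pq: "p \<in> gen f n" "q \<in> gen f n" for p q f n
  proof -
    obtain c c' where c: "\<forall>i<n. c i \<in> ?R" "p = (\<Sum>i<n. c i * f i)"
      "\<forall>i<n. c' i \<in> ?R" "q = (\<Sum>i<n. c' i * f i)"
      using pq by (auto simp: gen_def)
    have "p + q = (\<Sum>i<n. (c i + c' i) * f i)"
      by (simp add: c sum.distrib algebra_simps)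
    also have "\<dots> \<in> gen f n"
      by (rule genI) (use c subR in auto)
    finally show ?thesis .
  qed
  have gen_mult: "q * p \<in> gen f n" if pq: "p \<in> gen f n" "q \<in> ?R" for p q f n
  proof -
    obtain c where c: "\<forall>i<n. c i \<in> ?R" "p = (\<Sum>i<n. c i * f i)"
      using pq by (auto simp: gen_def)
    have "q * p = (\<Sum>i<n. (q * c i) * f i)"
      by (simp add: c sum_distrib_left algebra_simps)
    also have "\<dots> \<in> gen f n"
      by (rule genI) (use c subR that in auto)
    finally show ?thesis .
  qed
  have gen_0: "0 \<in> gen f n" for f n
    using genI[of n "\<lambda>_. 0" f] subR by simp
  have gen_base: "f i \<in> gen f n" if "i < n" for f i n
  proof -
    have "f i = (\<Sum>j<n. (if j = i then 1 else 0) * f j)"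
      using that by (simp add: if_distrib[of "\<lambda>x. x * _"] sum.delta cong: if_cong)
    also have "\<dots> \<in> gen f n"
      by (rule genI) (use subR in auto)
    finally show ?thesis .
  qed
  have gen_sum: "sum g I \<in> gen f n" if "\<And>i. i \<in> I \<Longrightarrow> g i \<in> gen f n" for g f n and I :: "nat set"
    using that by (induction I rule: infinite_finite_induct) (auto simp: gen_0 gen_add)
  have gen_sub: "gen f n \<subseteq> gen g m" if "\<And>i. i < n \<Longrightarrow> f i \<in> gen g m" for f g n m
    using that by (auto simp: gen_def[of f] intro!: gen_sum gen_mult)
  have gen_mono: "gen f n \<subseteq> gen f m" if "n \<le> m" for f n m
    by (rule gen_sub) (use that gen_base in auto)
  assume "\<not> noetherian_on ?R"
  then obtain r where r: "\<And>i. r i \<in> ?R" "\<And>n. r n \<notin> gen r n"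
    unfolding noetherian_on_def gen_def by blast
  define I where "I = (\<Union>n. gen r n)"
  have I_add: "p + q \<in> I" if "p \<in> I" "q \<in> I" for p q
  proof -
    obtain m n where "p \<in> gen r m" "q \<in> gen r n"
      using \<open>p \<in> I\<close> \<open>q \<in> I\<close> by (auto simp: I_def)
    then have "p \<in> gen r (max m n)" "q \<in> gen r (max m n)"
      using gen_mono[of m "max m n" r] gen_mono[of n "max m n" r] by auto
    then show ?thesis
      unfolding I_def using gen_add by blast
  qed
  have I_mult: "q * p \<in> I" if "p \<in> I" "q \<in> ?R" for p q
    using that gen_mult unfolding I_def by blast
  have I_sum: "sum g J \<in> I" if "\<And>i. i \<in> J \<Longrightarrow> g i \<in> I" for g and J :: "nat set"
  proof -
    have "0 \<in> I"
      unfolding I_def using gen_0 by blast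
    then show ?thesis
      using that by (induction J rule: infinite_finite_induct) (simp_all add: I_add)
  qed
  have I_R: "p \<in> ?R" if "p \<in> I" for p
    using that subR r by (auto simp: I_def gen_def intro!: add_subgroup_sum[OF subR(1)])
  have not_fg: "\<exists>p. p \<in> I \<and> p \<notin> gen f n" if f: "\<And>i. i < n \<Longrightarrow> f i \<in> I" for f n
  proof (rule ccontr)
    assume "\<not> ?thesis"
    then have sub: "I \<subseteq> gen f n" by blast
    have "\<exists>m. \<forall>i<k. f i \<in> gen r m" if "k \<le> n" for k
      using that
    proof (induction k)
      case 0
      then show ?case by auto
    next
      case (Suc k)
      then obtain m where m: "\<forall>i<k. f i \<in> gen r m" by auto
      obtain m' where m': "f k \<in> gen r m'"
        using f[of k] Suc.prems by (auto simp: I_def)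
      have "f i \<in> gen r (max m m')" if "i < Suc k" for i
        using m m' that gen_mono[of m "max m m'" r] gen_mono[of m' "max m m'" r]
        by (cases "i = k") auto
      then show ?case by blast
    qed
    then obtain m where "\<And>i. i < n \<Longrightarrow> f i \<in> gen r m"
      by blast
    then have "gen f n \<subseteq> gen r m"
      by (rule gen_sub)
    moreover have "r m \<in> I"
      unfolding I_def using gen_base[of m "Suc m" r] by blast
    ultimately show False
      using sub r(2) by blast
  qed
  have gen_cong: "gen f n = gen g n" if "\<And>i. i < n \<Longrightarrow> f i = g i" for f g n
    unfolding gen_def using that by (metis (no_types, lifting) lessThan_iff sum.cong)
  \<comment> \<open>The premise makes \<open>P f n p\<close> satisfiable for every \<open>f\<close>,
    as the choice principle demands. That the chosen elements do lie in \<open>I\<close> is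
    recovered afterwards by induction.\<close>
  define P where "P f n p \<longleftrightarrow> ((\<forall>i<n. f i \<in> I) \<longrightarrow> p \<in> I \<and> p \<notin> gen f n \<and>
      (\<forall>q. q \<in> I \<and> q \<notin> gen f n \<longrightarrow> degree p \<le> degree q))" for f n p
  have "\<exists>f. \<forall>n. P f n (f n)"
  proof (rule dependent_wellorder_choice)
    show "P f n p = P g n p" if "\<And>i. i < n \<Longrightarrow> f i = g i" for p f g n
      using that gen_cong[of n f g] by (auto simp: P_def)
    show "\<exists>p. P f n p" for n f
    proof (cases "\<forall>i<n. f i \<in> I")
      case False
      then show ?thesis by (auto simp: P_def)
    next
      case True
      then have "\<exists>p. p \<in> I \<and> p \<notin> gen f n"
        using not_fg by blast
      then obtain p where "p \<in> I \<and> p \<notin> gen f n"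
        by blast
      from ex_has_least_nat[of "\<lambda>p. p \<in> I \<and> p \<notin> gen f n", OF this, of degree]
      show ?thesis
        unfolding P_def by blast
    qed
  qed
  then obtain f where f: "\<And>n. P f n (f n)"
    by blast
  have fI: "f n \<in> I" for n
  proof (induction n rule: less_induct)
    case (less n)
    then show ?case
      using f[of n] by (auto simp: P_def)
  qed
  have f_notin: "f n \<notin> gen f n" and f_min: "\<And>q. q \<in> I \<Longrightarrow> q \<notin> gen f n \<Longrightarrow> degree (f n) \<le> degree q"
    for n
    using f[of n] fI by (auto simp: P_def)
  have deg_mono: "degree (f i) \<le> degree (f n)" if "i \<le> n" for i n
    by (rule f_min[OF fI]) (use f_notin gen_mono[OF that] in blast)
  have "lead_coeff (f i) \<in> A" for i
    using fI I_R by (auto simp: polys_over_def)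
  then obtain n c where c: "\<And>i. i < n \<Longrightarrow> c i \<in> A"
      "lead_coeff (f n) = (\<Sum>i<n. c i * lead_coeff (f i))"
    using noeth[unfolded noetherian_on_def, rule_format, of "\<lambda>i. lead_coeff (f i)"] by blast
  \<comment> \<open>The monomials lift each \<open>f i\<close> to the degree of \<open>f n\<close>,
    so that \<open>g\<close> has the leading term of \<open>f n\<close>. By minimality the
    difference cannot have smaller degree, so it would be zero although it lies outside the ideal of
    the earlier \<open>f i\<close>.\<close>
  define g where "g = (\<Sum>i<n. monom (c i) (degree (f n) - degree (f i)) * f i)"
  have g_gen: "g \<in> gen f n"
    unfolding g_def by (rule genI) (use c monom_polys_over[OF A] in auto)
  have deg_g: "degree g \<le> degree (f n)"
    unfolding g_def
  proof (rule degree_sum_le)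
    fix i assume "i \<in> {..<n}"
    then have "degree (f i) \<le> degree (f n)"
      using deg_mono by simp
    then show "degree (monom (c i) (degree (f n) - degree (f i)) * f i) \<le> degree (f n)"
      using degree_mult_le[of "monom (c i) (degree (f n) - degree (f i))" "f i"]
        degree_monom_le[of "c i" "degree (f n) - degree (f i)"] by linarith
  qed simp
  have "coeff g (degree (f n)) = lead_coeff (f n)"
    unfolding g_def c(2) coeff_sum
    by (rule sum.cong) (use deg_mono in \<open>auto simp: coeff_monom_mult\<close>)
  then have coeff0: "coeff (f n - g) (degree (f n)) = 0"
    by simp
  have g_R: "- 1 \<in> ?R"
    using subR by simp
  have gI: "g \<in> I"
    unfolding g_def by (intro I_sum I_mult fI monom_polys_over[OF A] c) auto
  have "f n - g \<in> I"
    using I_add[OF fI I_mult[OF gI g_R]] by simp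
  moreover have "f n - g \<notin> gen f n"
    using f_notin[of n] gen_add[OF _ g_gen, of "f n - g"] by auto
  ultimately have "degree (f n) \<le> degree (f n - g)"
    by (rule f_min)
  then have "degree (f n - g) = degree (f n)"
    using degree_diff_le[OF order_refl deg_g] by simp
  then have "f n - g = 0"
    using coeff0 by (metis leading_coeff_0_iff)
  then show False
    using \<open>f n - g \<notin> gen f n\<close> gen_0 by simp
qed

section \<open>Affine algebras are Noetherian\<close>

lemma noetherian_on_range_field:
  assumes "structure_map (\<iota> :: 'k::field \<Rightarrow> 'b::comm_ring_1)"
  shows "noetherian_on (range \<iota>)"
proof (rule noetherian_on_image)
  show "noetherian_on (UNIV :: 'k set)"
    unfolding noetherian_on_def
  proof (intro allI impI)
    fix r :: "nat \<Rightarrow> 'k"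
    show "\<exists>n c. (\<forall>i<n. c i \<in> UNIV) \<and> r n = (\<Sum>i<n. c i * r i)"
    proof (cases "r 0 = 0")
      case True
      then show ?thesis by (intro exI[of _ 0]) auto
    next
      case False
      then show ?thesis
        by (intro exI[of _ 1] exI[of _ "\<lambda>_. r 1 / r 0"]) auto
    qed
  qed
qed (use assms in \<open>auto simp: structure_map_def\<close>)

lemma unital_subring_image:
  assumes A: "unital_subring A" and one: "\<phi> 1 = 1"
    and add: "\<And>x y. \<phi> (x + y) = \<phi> x + \<phi> y" and mult: "\<And>x y. \<phi> (x * y) = \<phi> x * \<phi> y"
  shows "unital_subring (\<phi> ` A)"
proof -
  have zero: "\<phi> 0 = 0"
    using add[of 0 0] by simp
  have "\<phi> (- x) = - \<phi> x" for x
    using add[of x "- x"] by (simp add: zero eq_neg_iff_add_eq_0 add.commute)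
  then show ?thesis
    using unital_subringD[OF A] zero one add mult unfolding unital_subring_def add_subgroup_def
    by (auto; metis imageI)
qed

lemma structure_mapD:
  assumes "structure_map \<iota>"
  shows "\<iota> 1 = 1" "\<And>x y. \<iota> (x + y) = \<iota> x + \<iota> y" "\<And>x y. \<iota> (x * y) = \<iota> x * \<iota> y"
  using assms by (auto simp: structure_map_def)

text \<open>Generators are adjoined one at a time, by evaluating the polynomials over
  \<open>A\<close> at \<open>x\<close>; the Noetherian property passes to polynomials and then to
  the image.\<close>

lemma noetherian_on_affine:
  assumes \<iota>: "structure_map (\<iota> :: 'k::field \<Rightarrow> 'b::comm_ring_1)" and fg: "fg_algebra \<iota>"
  shows "noetherian_on (UNIV :: 'b set)"
proof -
  have "\<exists>A. unital_subring A \<and> noetherian_on A \<and> range \<iota> \<union> S \<subseteq> A" if "finite S" for S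
    using that
  proof induction
    case empty
    have "unital_subring (UNIV :: 'k set)"
      by (simp add: unital_subring_def add_subgroup_def)
    then have "unital_subring (range \<iota>)"
      using structure_mapD[OF \<iota>] by (intro unital_subring_image)
    then show ?case
      using noetherian_on_range_field[OF \<iota>] by auto
  next
    case (insert x S)
    then obtain A where A: "unital_subring A" "noetherian_on A" "range \<iota> \<union> S \<subseteq> A"
      by blast
    define A' where "A' = (\<lambda>p. poly p x) ` polys_over A"
    have "noetherian_on A'"
      unfolding A'_def using noetherian_on_polys_over[OF A(2,1)] by (rule noetherian_on_image) auto
    moreover have "unital_subring A'"
      unfolding A'_def using unital_subring_polys_over[OF A(1)] by (rule unital_subring_image) auto
    moreover have "a \<in> A'" if "a \<in> A" for a
      unfolding A'_def using monom_polys_over[OF A(1) that, of 0]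
      by (auto simp: image_iff poly_monom intro!: bexI[of _ "monom a 0"])
    moreover have "x \<in> A'"
      unfolding A'_def using monom_polys_over[OF A(1) unital_subringD(2)[OF A(1)], of 1]
      by (auto simp: image_iff poly_monom intro!: bexI[of _ "monom 1 1"])
    ultimately show ?case
      using A(3) by (intro exI[of _ A']) auto
  qed
  moreover obtain S where "finite S" "(\<lambda>A. unital_subring A \<and> range \<iota> \<subseteq> A) hull S = UNIV"
    using fg by (auto simp: fg_algebra_def)
  ultimately obtain A where "noetherian_on A" "unital_subring A" "range \<iota> \<union> S \<subseteq> A"
    "(\<lambda>A. unital_subring A \<and> range \<iota> \<subseteq> A) hull S = UNIV"
    by blast
  moreover from this have "A = UNIV"
    using hull_minimal[of S A "\<lambda>A. unital_subring A \<and> range \<iota> \<subseteq> A"] by auto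
  ultimately show ?thesis
    by simp
qed

section \<open>Ideals and the ascending chain condition\<close>

lemma ring_ideal_iff:
  "ring_ideal (I :: 'b::comm_ring_1 set) \<longleftrightarrow>
    0 \<in> I \<and> (\<forall>x\<in>I. \<forall>y\<in>I. x + y \<in> I) \<and> (\<forall>c. \<forall>x\<in>I. c * x \<in> I)"
proof -
  interpret module "(*) :: 'b \<Rightarrow> 'b \<Rightarrow> 'b"
    by unfold_locales (auto simp: algebra_simps)
  show ?thesis
    by (auto simp: ring_ideal_def subspace_def)
qed

lemma ring_ideal_sum:
  "ring_ideal I \<Longrightarrow> (\<And>i. i \<in> J \<Longrightarrow> f i \<in> I) \<Longrightarrow> sum f J \<in> I"
  by (induction J rule: infinite_finite_induct) (auto simp: ring_ideal_iff)

text \<open>Elements taken from successive gaps of an unbounded chain form a sequence in which no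
  term is a combination of the earlier ones.\<close>

lemma noetherian_on_chain:
  assumes noeth: "noetherian_on (UNIV :: 'b::comm_ring_1 set)"
    and ideal: "\<And>k. ring_ideal (I k :: 'b set)" and chain: "\<And>k. I k \<subseteq> I (Suc k)"
  shows "\<exists>k. \<forall>m. I m \<subseteq> I k"
proof (rule ccontr)
  assume no: "\<not> ?thesis"
  have mono: "I k \<subseteq> I m" if "k \<le> m" for k m
    using chain that by (rule subset_chain_le)
  have "\<exists>f. \<forall>k. True \<and> (f k \<le> f (Suc k) \<and> \<not> I (f (Suc k)) \<subseteq> I (f k))"
  proof (rule dependent_nat_choice)
    fix x :: nat and k :: nat
    obtain m where m: "\<not> I m \<subseteq> I x"
      using no by blast
    then have "x \<le> m"
      using mono nle_le by blast
    with m show "\<exists>y. True \<and> (x \<le> y \<and> \<not> I y \<subseteq> I x)"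
      by blast
  qed simp
  then obtain f where f: "\<And>k. f k \<le> f (Suc k)" "\<And>k. \<not> I (f (Suc k)) \<subseteq> I (f k)"
    by auto
  have "\<forall>k. \<exists>x. x \<in> I (f (Suc k)) - I (f k)"
    using f by blast
  then obtain r where r: "\<And>k. r k \<in> I (f (Suc k))" "\<And>k. r k \<notin> I (f k)"
    by (metis DiffE)
  obtain n c where nc: "r n = (\<Sum>i<n. c i * r i)"
    using noeth[unfolded noetherian_on_def, rule_format, of r] by auto
  have "c i * r i \<in> I (f n)" if "i < n" for i
  proof -
    have "f (Suc i) \<le> f n"
      using f(1) by (rule lift_Suc_mono_le) (use that in simp)
    then have "r i \<in> I (f n)"
      using r(1)[of i] mono by blast
    then show ?thesis
      using ideal by (simp add: ring_ideal_iff)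
  qed
  then have "r n \<in> I (f n)"
    unfolding nc by (intro ring_ideal_sum[OF ideal]) auto
  then show False
    using r by blast
qed

section \<open>Normal Noetherian domains\<close>

text \<open>The fraction u/v is almost integral: \<open>q\<close> is a common denominator of all its
  powers. The Noetherian relation among the ring elements q (u/v)^m, divided by \<open>q\<close>, is
  a monic equation for u/v.\<close>

lemma normal_dvdI:
  fixes u v q :: "'b::idom"
  assumes noeth: "noetherian_on (UNIV :: 'b set)" and normal: "normal_domain TYPE('b)"
    and q: "q \<noteq> 0" and v: "v \<noteq> 0" and dvd: "\<And>m. v ^ m dvd q * u ^ m"
  shows "v dvd u"
proof -
  define w where "w = to_fract u / to_fract v"
  have "\<forall>m. \<exists>r. q * u ^ m = v ^ m * r"
    using dvd by (auto elim: dvdE)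
  then obtain r where r: "\<And>m. q * u ^ m = v ^ m * r m"
    by metis
  have pow: "to_fract (x ^ m) = to_fract x ^ m" for x :: 'b and m
    by (induction m) simp_all
  have rw: "to_fract (r m) = to_fract q * w ^ m" for m
    using arg_cong[OF r[of m], of to_fract] v
    by (simp add: w_def pow power_divide field_simps)
  obtain n c where nc: "r n = (\<Sum>i<n. c i * r i)"
    using noeth[unfolded noetherian_on_def, rule_format, of r] by auto
  have "to_fract q * w ^ n = to_fract q * (\<Sum>i<n. to_fract (c i) * w ^ i)"
    using arg_cong[OF nc, of to_fract] by (simp add: rw sum_distrib_left mult_ac)
  then have wn: "w ^ n = (\<Sum>i<n. to_fract (c i) * w ^ i)"
    using q by simp
  define s where "s = (\<Sum>i<n. monom (c i) i)"
  define p where "p = monom 1 n - s"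
  have s_coeff: "coeff s i = 0" if "i \<ge> n" for i
    using that by (auto simp: s_def coeff_sum intro!: sum.neutral)
  have "degree p \<le> n"
    by (rule degree_le) (auto simp: p_def s_coeff)
  moreover have "coeff p n = 1"
    by (simp add: p_def s_coeff)
  ultimately have "lead_coeff p = 1"
    by (metis le_antisym le_degree zero_neq_one)
  moreover have "poly (map_poly to_fract p) w = 0"
  proof -
    have diff: "map_poly to_fract (x - y) = map_poly to_fract x - map_poly to_fract y"
      for x y :: "'b poly"
      by (intro poly_eqI) (simp add: coeff_map_poly)
    have sum: "map_poly to_fract (\<Sum>i<n. monom (c i) i) = (\<Sum>i<n. monom (to_fract (c i)) i)" for n
      by (intro poly_eqI) (simp add: coeff_map_poly coeff_sum if_distrib[of to_fract])
    show ?thesis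
      by (simp add: p_def s_def diff sum map_poly_monom poly_monom poly_sum wn)
  qed
  ultimately have "w \<in> range to_fract"
    using normal unfolding normal_domain_def integral_over_domain_def by blast
  then obtain x where "to_fract u = to_fract (v * x)"
    using v by (auto simp: w_def field_simps)
  then show ?thesis
    by (simp only: to_fract_eq_iff) simp
qed

lemma height_eq_1I:
  fixes P :: "'b::idom set"
  assumes P: "prime_ideal P" and x: "x \<in> P" "x \<noteq> 0"
    and min: "\<And>Q. \<lbrakk>prime_ideal Q; Q \<subset> P\<rbrakk> \<Longrightarrow> Q = {0}"
  shows "height P = 1"
proof -
  let ?N = "{n. \<exists>C :: nat \<Rightarrow> 'b set.
     C n = P \<and> (\<forall>i\<le>n. prime_ideal (C i)) \<and> (\<forall>i<n. C i \<subset> C (Suc i))}"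
  have zero: "0 \<in> Q" if "prime_ideal Q" for Q :: "'b set"
    using that by (auto simp: prime_ideal_def ring_ideal_iff)
  have "prime_ideal {0 :: 'b}"
    by (auto simp: prime_ideal_def ring_ideal_iff set_eq_iff intro: exI[of _ 1])
  then have "1 \<in> ?N"
    using P x zero[OF P]
    by (auto simp: le_Suc_eq intro!: exI[of _ "\<lambda>i. if i = 0 then {0} else P"])
  then have "enat 1 \<le> height P"
    unfolding height_def by (rule SUP_upper)
  moreover have "n \<le> 1" if "n \<in> ?N" for n
  proof (rule ccontr)
    assume "\<not> n \<le> 1"
    then have m: "n = Suc (Suc (n - 2))"
      by simp
    define m where "m = n - 2"
    note m = m[folded m_def]
    \<comment> \<open>In a chain of length at least two the term just below \<open>P\<close> is zero
      by \<open>min\<close>, which leaves no room for the term below it.\<close>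
    obtain C where C: "C n = P" "\<forall>i\<le>n. prime_ideal (C i)" "\<forall>i<n. C i \<subset> C (Suc i)"
      using \<open>n \<in> ?N\<close> by blast
    have "prime_ideal (C (Suc m))" "C (Suc m) \<subset> P"
      using C(1) C(2)[rule_format, of "Suc m"] C(3)[rule_format, of "Suc m"] m by simp_all
    then have "C (Suc m) = {0}"
      by (rule min)
    moreover have "0 \<in> C m"
      by (rule zero) (use C m in simp)
    moreover have "C m \<subset> C (Suc m)"
      using C(3) m by simp
    ultimately show False
      by auto
  qed
  then have "height P \<le> enat 1"
    unfolding height_def by (intro SUP_least) auto
  ultimately show ?thesis
    by (simp add: one_enat_def)
qed

text \<open>If \<open>c / f\<close> is not in the ring, a maximal ideal of denominators
  \<open>{z. f dvd z * (c * s)}\<close> of multiples of \<open>c / f\<close> is a prime \<open>P\<close>. By integrality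
  \<open>P (c * s / f) \<subseteq> P\<close> fails, so \<open>P\<close> becomes principal after localization, with generator \<open>p\<close>.\<close>

lemma normal_dvd_of_Spec1:
  fixes c f :: "'b::idom"
  assumes noeth: "noetherian_on (UNIV :: 'b set)" and normal: "normal_domain TYPE('b)"
    and f: "f \<noteq> 0" and loc: "\<And>P. P \<in> Spec1 \<Longrightarrow> \<exists>z. z \<notin> P \<and> f dvd z * c"
  shows "f dvd c"
proof (rule ccontr)
  assume ndvd: "\<not> f dvd c"
  define den where "den s = {z. f dvd z * (c * s)}" for s
  define S where "S = {den s | s. \<not> f dvd c * s}"
  have ideal: "ring_ideal (den s)" for s
    by (auto simp: den_def ring_ideal_iff algebra_simps)
  have "den 1 \<in> S"
    using ndvd by (auto simp: S_def)
  then have "\<exists>M\<in>S. den 1 \<subseteq> M \<and> (\<forall>Y\<in>S. M \<subseteq> Y \<longrightarrow> Y = M)"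
  proof (rule maximal_above)
    fix C :: "nat \<Rightarrow> 'b set"
    assume C: "\<And>k. C k \<in> S" "\<And>k. C k \<subseteq> C (Suc k)"
    have "ring_ideal (C k)" for k
      using C(1)[of k] ideal by (auto simp: S_def)
    from noetherian_on_chain[of C, OF noeth this C(2)] obtain k where "\<forall>m. C m \<subseteq> C k"
      by blast
    then show "\<exists>k. C (Suc k) = C k"
      using C(2) by blast
  qed
  then obtain M where M: "M \<in> S" "\<forall>Y\<in>S. M \<subseteq> Y \<longrightarrow> Y = M"
    by auto
  then obtain s where s: "\<not> f dvd c * s" and Ms: "M = den s"
    by (auto simp: S_def)
  have max: "den t = den s" if "\<not> f dvd c * t" "den s \<subseteq> den t" for t
    using M(2) that unfolding Ms S_def by auto
  define P where "P = den s"
  define w where "w = c * s"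
  have P: "z \<in> P \<longleftrightarrow> f dvd z * w" for z
    by (simp add: P_def den_def w_def)
  have P_ideal: "ring_ideal P"
    unfolding P_def by (rule ideal)
  have P_mult: "x * y \<in> P" if "y \<in> P" for x y
    using P_ideal that by (simp add: ring_ideal_iff)
  have fP: "f \<in> P"
    by (simp add: P)
  have oneP: "1 \<notin> P"
    using s by (simp add: P w_def)
  \<comment> \<open>Multiplying \<open>s\<close> by some \<open>x\<close> outside \<open>P\<close>
    keeps the fraction outside the ring and can only enlarge its ideal of denominators, so
    maximality forces equality.\<close>
  have P_prime: "y \<in> P" if "x * y \<in> P" "x \<notin> P" for x y
  proof -
    have "\<not> f dvd c * (s * x)"
      using that by (simp add: P w_def mult_ac)
    moreover have "den s \<subseteq> den (s * x)"
      by (auto simp: den_def) (metis dvd_mult2 mult.assoc)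
    ultimately have "den (s * x) = den s"
      by (rule max)
    moreover have "y \<in> den (s * x)"
      using that by (simp add: P w_def den_def mult_ac)
    ultimately show ?thesis
      by (simp add: P_def)
  qed
  then have prime: "prime_ideal P"
    unfolding prime_ideal_def using P_ideal oneP by blast
  \<comment> \<open>Otherwise multiplication by w/f maps \<open>P\<close> into itself, so
    \<open>f\<close> is a common denominator of all powers of w/f, and normality puts w/f into the
    ring.\<close>
  have "\<exists>p\<in>P. \<exists>v. v \<notin> P \<and> p * w = f * v"
  proof (rule ccontr)
    assume no: "\<not> ?thesis"
    have "\<exists>z\<in>P. f * w ^ m = f ^ m * z" for m
    proof (induction m)
      case 0
      then show ?case using fP by auto
    next
      case (Suc m)
      then obtain z where z: "z \<in> P" "f * w ^ m = f ^ m * z" by blast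
      then obtain v where v: "z * w = f * v"
        using P by (auto elim: dvdE)
      then have "v \<in> P"
        using no z by blast
      have "f * w ^ Suc m = (f * w ^ m) * w"
        by (simp add: mult_ac)
      also have "\<dots> = f ^ m * (z * w)"
        by (simp only: z mult.assoc)
      also have "\<dots> = f ^ Suc m * v"
        unfolding v by (simp add: mult_ac)
      finally show ?case
        using \<open>v \<in> P\<close> by blast
    qed
    then have "f ^ m dvd f * w ^ m" for m
      by (metis dvd_triv_left)
    then have "f dvd w"
      by (rule normal_dvdI[OF noeth normal f f])
    then show False
      using s by (simp add: w_def)
  qed
  then obtain p v where p: "p \<in> P" and v: "v \<notin> P" and pv: "p * w = f * v"
    by blast
  have principal: "\<exists>r. q * v = p * r" if "q \<in> P" for q
  proof -
    obtain r where "q * w = f * r"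
      using \<open>q \<in> P\<close> P by (auto elim: dvdE)
    then have "f * (q * v) = f * (p * r)"
      using pv by (metis mult.left_commute)
    then show ?thesis
      using f by auto
  qed
  have "p \<noteq> 0"
    using pv f v P_ideal by (auto simp: ring_ideal_iff)
  have "height P = 1"
  proof (rule height_eq_1I[OF prime fP f])
    fix Q :: "'b set"
    assume Q: "prime_ideal Q" "Q \<subset> P"
    have Q_mult: "x * y \<in> Q" if "x \<in> Q" for x y
      using Q that unfolding prime_ideal_def ring_ideal_iff by (metis mult.commute)
    have Q_prime: "y \<in> Q" if "x * y \<in> Q" "x \<notin> Q" for x y
      using Q that by (auto simp: prime_ideal_def)
    have vQ: "v \<notin> Q"
      using v Q by blast
    have pQ: "p \<notin> Q"
    proof
      assume "p \<in> Q"
      have "P \<subseteq> Q"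
      proof
        fix q assume "q \<in> P"
        then have "v * q \<in> Q"
          using principal Q_mult[OF \<open>p \<in> Q\<close>] by (metis mult.commute)
        then show "q \<in> Q"
          using Q_prime vQ by blast
      qed
      then show False
        using Q by blast
    qed
    show "Q = {0}"
    proof (rule ccontr)
      assume "Q \<noteq> {0}"
      then obtain q where q: "q \<in> Q" "q \<noteq> 0"
        using Q by (auto simp: prime_ideal_def ring_ideal_iff)
      \<comment> \<open>Locally \<open>v\<close> is a unit, and \<open>q\<close> would be divisible
        by every power of \<open>p\<close>. Read as a statement on the powers of v/p, this makes v/p
        almost integral, hence an element of the ring, and \<open>v\<close> would lie in
        \<open>P\<close>.\<close>
      have "\<exists>r\<in>Q. q * v ^ m = p ^ m * r" for m
      proof (induction m)
        case 0
        then show ?case using q by auto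
      next
        case (Suc m)
        then obtain r where r: "r \<in> Q" "q * v ^ m = p ^ m * r" by blast
        then obtain t where t: "r * v = p * t"
          using principal Q by blast
        then have "t \<in> Q"
          using Q_prime[of p t] Q_mult[OF r(1), of v] pQ by simp
        have "q * v ^ Suc m = (q * v ^ m) * v"
          by (simp add: mult_ac)
        also have "\<dots> = p ^ m * (r * v)"
          by (simp only: r mult.assoc)
        also have "\<dots> = p ^ Suc m * t"
          unfolding t by (simp add: mult_ac)
        finally show ?case
          using \<open>t \<in> Q\<close> by blast
      qed
      then have "p ^ m dvd q * v ^ m" for m
        by (metis dvd_triv_left)
      then have "p dvd v"
        by (rule normal_dvdI[OF noeth normal q(2) \<open>p \<noteq> 0\<close>])
      then show False
        using v p P_mult by (metis dvdE mult.commute)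
    qed
  qed
  then have "P \<in> Spec1"
    using prime by (simp add: Spec1_def)
  then obtain z where "z \<notin> P" "f dvd z * c"
    using loc by blast
  then show False
    by (auto simp: P w_def mult.assoc[symmetric])
qed

section \<open>Graded rings\<close>

locale grading =
  fixes B :: "'g::ab_group_add \<Rightarrow> 'b::idom set"
  assumes graded: "graded_ring B" and one_mem: "1 \<in> B 0"
begin

lemma subgroup: "add_subgroup (B i)"
  and mult_mem: "x \<in> B i \<Longrightarrow> y \<in> B j \<Longrightarrow> x * y \<in> B (i + j)"
  using graded by (auto simp: graded_ring_def)

lemma zero_mem [simp]: "0 \<in> B i"
  and add_mem: "x \<in> B i \<Longrightarrow> y \<in> B i \<Longrightarrow> x + y \<in> B i"
  and diff_mem: "x \<in> B i \<Longrightarrow> y \<in> B i \<Longrightarrow> x - y \<in> B i"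
  and uminus_mem: "x \<in> B i \<Longrightarrow> - x \<in> B i"
  using subgroup[of i]
  by (auto intro: add_subgroup_zero add_subgroup_add add_subgroup_diff add_subgroup_minus)

lemma power_mem: "x \<in> B i \<Longrightarrow> x ^ n \<in> B (nmul n i)"
  by (induction n) (auto simp: one_mem intro: mult_mem)

lemma of_nat_mem: "of_nat n \<in> B 0"
  by (induction n) (auto simp: one_mem intro: add_mem)

lemma of_nat_mult_mem: "x \<in> B i \<Longrightarrow> of_nat n * x \<in> B i"
  using mult_mem[OF of_nat_mem] by force

definition comp :: "'b \<Rightarrow> 'g \<Rightarrow> 'b" where
  "comp b = (THE f. hom_family B f \<and> b = (\<Sum>i | f i \<noteq> 0. f i))"

lemma comp_unique:
  assumes "hom_family B f" "finite I" "{i. f i \<noteq> 0} \<subseteq> I" "b = (\<Sum>i\<in>I. f i)"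
  shows "comp b = f"
proof -
  have "b = (\<Sum>i | f i \<noteq> 0. f i)"
    unfolding assms(4) by (rule sum.mono_neutral_right) (use assms in auto)
  moreover have "\<exists>!f. hom_family B f \<and> b = (\<Sum>i | f i \<noteq> 0. f i)"
    using graded by (simp add: graded_ring_def)
  ultimately show ?thesis
    unfolding comp_def using assms(1) by (intro the1_equality) auto
qed

lemma comp_props: "hom_family B (comp b) \<and> b = (\<Sum>i | comp b i \<noteq> 0. comp b i)"
  unfolding comp_def
  by (rule theI'[of "\<lambda>f. hom_family B f \<and> b = (\<Sum>i | f i \<noteq> 0. f i)"])
    (use graded in \<open>simp add: graded_ring_def\<close>)

lemma comp_mem: "comp b i \<in> B i"
  and finite_comp: "finite {i. comp b i \<noteq> 0}"
  and sum_comp': "b = (\<Sum>i | comp b i \<noteq> 0. comp b i)"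
  using comp_props[of b] by (auto simp: hom_family_def)

lemma sum_comp: "finite I \<Longrightarrow> {i. comp b i \<noteq> 0} \<subseteq> I \<Longrightarrow> (\<Sum>i\<in>I. comp b i) = b"
  using sum_comp'[of b] by (simp add: sum.mono_neutral_left[of I "{i. comp b i \<noteq> 0}"] Collect_mono_iff)

lemma comp_add: "comp (a + b) i = comp a i + comp b i"
proof -
  let ?I = "{i. comp a i \<noteq> 0} \<union> {i. comp b i \<noteq> 0}"
  have "comp (a + b) = (\<lambda>i. comp a i + comp b i)"
  proof (rule comp_unique)
    show fin: "finite ?I"
      by (simp add: finite_comp)
    show sub: "{i. comp a i + comp b i \<noteq> 0} \<subseteq> ?I"
      by auto
    show "hom_family B (\<lambda>i. comp a i + comp b i)"
      using comp_mem add_mem finite_subset[OF sub fin] by (auto simp: hom_family_def)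
    show "a + b = (\<Sum>i\<in>?I. comp a i + comp b i)"
      using fin by (simp add: sum.distrib sum_comp)
  qed
  then show ?thesis by simp
qed

lemma comp_homogeneous: "b \<in> B i \<Longrightarrow> comp b j = (if j = i then b else 0)"
  by (subst comp_unique[of "\<lambda>j. if j = i then b else 0" "{i}" b])
    (auto simp: hom_family_def intro: finite_subset[of _ "{i}"])

lemma comp_mult_homogeneous:
  assumes z: "z \<in> B j"
  shows "comp (z * c) (i + j) = z * comp c i"
proof -
  have "comp (z * c) = (\<lambda>k. z * comp c (k - j))"
  proof (rule comp_unique)
    let ?I = "(\<lambda>i. i + j) ` {i. comp c i \<noteq> 0}"
    show fin: "finite ?I"
      by (simp add: finite_comp)
    show sub: "{k. z * comp c (k - j) \<noteq> 0} \<subseteq> ?I"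
      by (auto simp: image_iff) (metis diff_add_cancel)
    show "hom_family B (\<lambda>k. z * comp c (k - j))"
      using mult_mem[OF z comp_mem] finite_subset[OF sub fin]
      by (auto simp: hom_family_def) (metis add_diff_cancel_left' add.commute diff_add_cancel)
    show "z * c = (\<Sum>k\<in>?I. z * comp c (k - j))"
      by (subst sum.reindex) (simp_all add: sum_distrib_left[symmetric] flip: sum_comp')
  qed
  then show ?thesis by simp
qed

text \<open>Comparing components of degree \<open>i + j\<close> and cancelling \<open>z\<close>
  shows that \<open>c\<close> is its own component of degree \<open>i\<close>. This supplies the
  degrees of all values that are later defined by division.\<close>

lemma homogeneous_cancel:
  assumes z: "z \<in> B j" "z \<noteq> 0" and zc: "z * c \<in> B (i + j)"
  shows "c \<in> B i"
proof -
  have "z * c = z * comp c i"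
    using comp_mult_homogeneous[OF z(1), of c i] comp_homogeneous[OF zc, of "i + j"] by simp
  then show ?thesis
    using z comp_mem[of c i] by simp
qed

lemma homogeneous_cancel':
  assumes "z \<in> B j" "z \<noteq> 0" "z * c \<in> B k"
  shows "c \<in> B (k - j)"
  by (rule homogeneous_cancel[OF assms(1,2)]) (use assms(3) in simp)

lemma part_iff: "b \<in> part B H \<longleftrightarrow> (\<forall>i. comp b i \<noteq> 0 \<longrightarrow> i \<in> H)"
proof
  assume "b \<in> part B H"
  then obtain f where "hom_family B f" "\<forall>i. f i \<noteq> 0 \<longrightarrow> i \<in> H" "b = (\<Sum>i | f i \<noteq> 0. f i)"
    by (auto simp: part_def)
  moreover from this have "comp b = f"
    by (intro comp_unique) (auto simp: hom_family_def)
  ultimately show "\<forall>i. comp b i \<noteq> 0 \<longrightarrow> i \<in> H"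
    by simp
next
  assume "\<forall>i. comp b i \<noteq> 0 \<longrightarrow> i \<in> H"
  then show "b \<in> part B H"
    unfolding part_def using comp_props[of b] by blast
qed

lemma homogeneous_part: "i \<in> H \<Longrightarrow> b \<in> B i \<Longrightarrow> b \<in> part B H"
  by (auto simp: part_iff comp_homogeneous)

lemma unital_subring_part:
  assumes H: "add_subgroup H"
  shows "unital_subring (part B H)"
proof -
  have add: "x + y \<in> part B H" if "x \<in> part B H" "y \<in> part B H" for x y
    using that unfolding part_iff comp_add by (metis add_0)
  have zero: "0 \<in> part B H"
    using homogeneous_part[OF add_subgroup_zero[OF H]] by simp
  have one: "1 \<in> part B H"
    using homogeneous_part[OF add_subgroup_zero[OF H]] one_mem by simp
  have sum: "sum f I \<in> part B H" if "\<And>i. i \<in> I \<Longrightarrow> f i \<in> part B H" for f and I :: "'g set"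
    using that by (induction I rule: infinite_finite_induct) (auto simp: zero add)
  have mult: "x * y \<in> part B H" if xy: "x \<in> part B H" "y \<in> part B H" for x y
  proof -
    have "x * y = (\<Sum>i | comp x i \<noteq> 0. \<Sum>j | comp y j \<noteq> 0. comp x i * comp y j)"
      by (simp only: sum_product[symmetric] flip: sum_comp')
    also have "\<dots> \<in> part B H"
    proof (intro sum)
      fix i j assume "i \<in> {i. comp x i \<noteq> 0}" "j \<in> {j. comp y j \<noteq> 0}"
      then have "i + j \<in> H"
        using xy H by (auto simp: part_iff intro: add_subgroup_add)
      then show "comp x i * comp y j \<in> part B H"
        by (rule homogeneous_part) (intro mult_mem comp_mem)
    qed
    finally show ?thesis .
  qed
  have "- x \<in> part B H" if "x \<in> part B H" for x
    using mult[OF homogeneous_part[OF add_subgroup_zero[OF H] uminus_mem[OF one_mem]] that] by simp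
  then show ?thesis
    using add zero one mult by (simp add: unital_subring_def add_subgroup_def)
qed

lemma mem_GG: "b \<in> B i \<Longrightarrow> b \<noteq> 0 \<Longrightarrow> i \<in> GG B"
  unfolding GG_def by (rule group_closure.base) auto

end

section \<open>Derivations, local nilpotence and the degree function\<close>

locale derivation =
  fixes R :: "'b::idom set" and D :: "'b \<Rightarrow> 'b"
  assumes subring: "unital_subring R" and derivation: "derivation_on R D"
begin

lemmas R = unital_subringD[OF subring]

lemma R_power: "x \<in> R \<Longrightarrow> x ^ n \<in> R"
  by (induction n) (auto intro: R)

lemma R_of_nat: "of_nat n \<in> R"
  by (induction n) (auto intro: R)

lemma D_mem: "x \<in> R \<Longrightarrow> D x \<in> R"
  and D_add: "x \<in> R \<Longrightarrow> y \<in> R \<Longrightarrow> D (x + y) = D x + D y"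
  and D_mult: "x \<in> R \<Longrightarrow> y \<in> R \<Longrightarrow> D (x * y) = D x * y + x * D y"
  using derivation by (auto simp: derivation_on_def)

lemma D_0 [simp]: "D 0 = 0"
  using D_add[of 0 0] R(3) by (metis add_cancel_left_right add_0)

lemma D_1 [simp]: "D 1 = 0"
  using D_mult[of 1 1] R(2) by (metis add_cancel_left_right mult_1 mult_1_right)

lemma D_diff: "x \<in> R \<Longrightarrow> y \<in> R \<Longrightarrow> D (x - y) = D x - D y"
  using D_add[of "x - y" y] R by (simp add: algebra_simps)

lemma D_of_nat [simp]: "D (of_nat n) = 0"
  by (induction n) (simp_all add: D_add R_of_nat R)

lemma D_power: "x \<in> R \<Longrightarrow> D (x ^ Suc n) = of_nat (Suc n) * x ^ n * D x"
proof (induction n)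
  case (Suc n)
  have "D (x ^ Suc (Suc n)) = D x * x ^ Suc n + x * D (x ^ Suc n)"
    using D_mult[OF Suc.prems R_power[OF Suc.prems, of "Suc n"]] by simp
  also have "\<dots> = of_nat (Suc (Suc n)) * x ^ Suc n * D x"
    unfolding Suc.IH[OF Suc.prems] by (simp add: algebra_simps)
  finally show ?case .
qed simp

lemma D_power_eq:
  assumes "x \<in> R" "n > 0"
  shows "D (x ^ n) = of_nat n * x ^ (n - 1) * D x"
  using D_power[OF assms(1), of "n - 1"] assms(2) by simp

lemma D_kernel_mult: "c \<in> R \<Longrightarrow> D c = 0 \<Longrightarrow> x \<in> R \<Longrightarrow> D (c * x) = c * D x"
  by (simp add: D_mult)

lemma D_kernel_power: "c \<in> R \<Longrightarrow> D c = 0 \<Longrightarrow> D (c ^ n) = 0"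
  by (cases n) (simp_all add: D_power del: power_Suc)

lemma funpow_mem: "x \<in> R \<Longrightarrow> (D ^^ n) x \<in> R"
  by (induction n) (auto intro: D_mem)

lemma funpow_0 [simp]: "(D ^^ n) 0 = 0"
  by (induction n) simp_all

lemma funpow_add_R: "x \<in> R \<Longrightarrow> y \<in> R \<Longrightarrow> (D ^^ n) (x + y) = (D ^^ n) x + (D ^^ n) y"
  by (induction n) (simp_all add: D_add funpow_mem)

lemma funpow_diff: "x \<in> R \<Longrightarrow> y \<in> R \<Longrightarrow> (D ^^ n) (x - y) = (D ^^ n) x - (D ^^ n) y"
  by (induction n) (simp_all add: D_diff funpow_mem)

lemma funpow_kernel_mult:
  "c \<in> R \<Longrightarrow> D c = 0 \<Longrightarrow> x \<in> R \<Longrightarrow> (D ^^ n) (c * x) = c * (D ^^ n) x"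
  by (induction n) (simp_all add: D_kernel_mult funpow_mem)

lemma funpow_eq_0_mono:
  assumes "(D ^^ m) x = 0" "m \<le> n"
  shows "(D ^^ n) x = 0"
proof -
  have "(D ^^ n) x = (D ^^ (n - m)) ((D ^^ m) x)"
    using assms(2) by (metis comp_apply funpow_add le_add_diff_inverse2)
  then show ?thesis
    using assms(1) by simp
qed

text \<open>Serves to match, and then subtract, the top term of an element expanded in powers of a
  local slice.\<close>

lemma funpow_local_slice:
  assumes x: "x \<in> R" and D2: "D (D x) = 0"
  shows "(D ^^ m) (x ^ m) = of_nat (fact m) * D x ^ m"
proof (induction m)
  case (Suc m)
  have c: "of_nat (Suc m) * D x \<in> R"
    by (intro R R_of_nat D_mem x)
  moreover have "D (of_nat (Suc m) * D x) = 0"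
    using D_mult[OF R_of_nat D_mem[OF x], of "Suc m"] D2 by (simp del: of_nat_Suc)
  moreover have "D (x ^ Suc m) = (of_nat (Suc m) * D x) * x ^ m"
    using D_power[OF x] by (simp add: mult_ac del: power_Suc)
  ultimately have "(D ^^ m) (D (x ^ Suc m)) = (of_nat (Suc m) * D x) * (D ^^ m) (x ^ m)"
    using funpow_kernel_mult R_power[OF x] by metis
  then show ?case
    unfolding funpow_Suc_right comp_apply Suc.IH by (simp add: algebra_simps)
qed simp

text \<open>A single term of the Leibniz expansion survives at this order. The factor
  \<open>c\<close> arises by Pascal's recursion, and positivity is all that is kept of it: in
  characteristic zero this makes the degree function additive.\<close>

lemma funpow_mult_top:
  assumes "f \<in> R" "g \<in> R" "(D ^^ Suc m) f = 0" "(D ^^ Suc l) g = 0"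
  shows "\<exists>c>0. (D ^^ (m + l)) (f * g) = of_nat c * ((D ^^ m) f * (D ^^ l) g)"
  using assms
proof (induction "m + l" arbitrary: m l f g rule: less_induct)
  case less
  show ?case
  proof (cases m)
    case 0
    then have "D f = 0"
      using less.prems by simp
    then show ?thesis
      using less.prems 0 funpow_kernel_mult[of f g l] by (intro exI[of _ 1]) auto
  next
    case (Suc m')
    note m = this
    show ?thesis
    proof (cases l)
      case 0
      then have "D g = 0"
        using less.prems by simp
      then show ?thesis
        using less.prems 0 funpow_kernel_mult[of g f m]
        by (intro exI[of _ 1]) (auto simp: mult.commute)
    next
      case (Suc l')
      note l = this
      have Df: "D f \<in> R" "(D ^^ Suc m') (D f) = 0" and Dg: "D g \<in> R" "(D ^^ Suc l') (D g) = 0"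
        using less.prems m l D_mem by (simp_all add: funpow_swap1)
      obtain c where c: "c > 0"
        "(D ^^ (m' + l)) (D f * g) = of_nat c * ((D ^^ m') (D f) * (D ^^ l) g)"
        using less.hyps[of m' l "D f" g] Df less.prems m by auto
      obtain c' where c': "c' > 0"
        "(D ^^ (m + l')) (f * D g) = of_nat c' * ((D ^^ m) f * (D ^^ l') (D g))"
        using less.hyps[of m l' f "D g"] Dg less.prems l by auto
      have "(D ^^ (m + l)) (f * g) = (D ^^ (m' + l)) (D f * g + f * D g)"
        using less.prems m by (simp add: funpow_swap1 D_mult)
      also have "\<dots> = (D ^^ (m' + l)) (D f * g) + (D ^^ (m' + l)) (f * D g)"
        by (intro funpow_add_R R less.prems Df Dg)
      also have "\<dots> = of_nat c * ((D ^^ m') (D f) * (D ^^ l) g) +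
          of_nat c' * ((D ^^ m) f * (D ^^ l') (D g))"
        using c c' m l by simp
      also have "\<dots> = of_nat (c + c') * ((D ^^ m) f * (D ^^ l) g)"
        using m l by (simp add: funpow_swap1 algebra_simps)
      finally show ?thesis
        using c by (intro exI[of _ "c + c'"]) auto
    qed
  qed
qed

end

locale lnd = derivation R D for R :: "'b::idom set" and D +
  assumes nilpotent: "locally_nilpotent_on R D"
    and char0: "\<And>n. n > 0 \<Longrightarrow> of_nat n \<noteq> (0 :: 'b)"
begin

text \<open>The degree function of \<open>D\<close>, with junk value \<open>0\<close> at \<open>0\<close>.\<close>

definition ldeg :: "'b \<Rightarrow> nat" where
  "ldeg b = (LEAST m. (D ^^ Suc m) b = 0)"

lemma ldeg_Suc:
  assumes "b \<in> R"
  shows "(D ^^ Suc (ldeg b)) b = 0"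
proof -
  obtain n where "n > 0" "(D ^^ n) b = 0"
    using nilpotent assms by (auto simp: locally_nilpotent_on_def)
  then have "(D ^^ Suc (n - 1)) b = 0"
    by simp
  then show ?thesis
    unfolding ldeg_def by (rule LeastI)
qed

lemma ldeg_neq_0:
  assumes "b \<noteq> 0"
  shows "(D ^^ ldeg b) b \<noteq> 0"
proof (cases "ldeg b")
  case 0
  then show ?thesis using assms by simp
next
  case (Suc m)
  then have "m < (LEAST m. (D ^^ Suc m) b = 0)"
    by (simp add: ldeg_def)
  then show ?thesis
    using not_less_Least[of m "\<lambda>m. (D ^^ Suc m) b = 0"] Suc by auto
qed

lemma ldeg_eqI:
  assumes "(D ^^ m) b \<noteq> 0" "(D ^^ Suc m) b = 0"
  shows "ldeg b = m"
  unfolding ldeg_def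
proof (rule Least_equality)
  show "(D ^^ Suc m) b = 0" by (rule assms)
  show "m \<le> y" if "(D ^^ Suc y) b = 0" for y
    using funpow_eq_0_mono[OF that, of m] assms(1) by (metis not_less_eq_eq)
qed

lemma ldeg_mult:
  assumes f: "f \<in> R" "f \<noteq> 0" and g: "g \<in> R" "g \<noteq> 0"
  shows "ldeg (f * g) = ldeg f + ldeg g"
proof (rule ldeg_eqI)
  let ?m = "ldeg f" and ?l = "ldeg g"
  note top = ldeg_Suc[OF f(1)] ldeg_Suc[OF g(1)]
  obtain c where c: "c > 0"
    "(D ^^ (?m + ?l)) (f * g) = of_nat c * ((D ^^ ?m) f * (D ^^ ?l) g)"
    using funpow_mult_top[OF f(1) g(1) top] by blast
  then show "(D ^^ (?m + ?l)) (f * g) \<noteq> 0"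
    using char0 ldeg_neq_0 f g by simp
  \<comment> \<open>Overstating the order of \<open>f\<close> by one makes the surviving term itself
    zero.\<close>
  obtain c where c: "(D ^^ (Suc ?m + ?l)) (f * g) = of_nat c * ((D ^^ Suc ?m) f * (D ^^ ?l) g)"
    using funpow_mult_top[of f g "Suc ?m" ?l] f g top by auto
  then show "(D ^^ Suc (?m + ?l)) (f * g) = 0"
    using top by (simp only: add_Suc) simp
qed

lemma ldeg_power: "f \<in> R \<Longrightarrow> f \<noteq> 0 \<Longrightarrow> ldeg (f ^ n) = n * ldeg f"
proof (induction n)
  case 0
  show ?case
    by (simp, rule ldeg_eqI) simp_all
qed (simp add: ldeg_mult R_power)

lemma ldeg_kernel: "D f = 0 \<Longrightarrow> f \<noteq> 0 \<Longrightarrow> ldeg f = 0"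
  by (rule ldeg_eqI) simp_all

lemma ldeg_of_nat_mult: "f \<in> R \<Longrightarrow> f \<noteq> 0 \<Longrightarrow> n > 0 \<Longrightarrow> ldeg (of_nat n * f) = ldeg f"
  by (simp add: ldeg_mult ldeg_kernel char0 R_of_nat)

lemma ldeg_D:
  assumes "f \<in> R" "D f \<noteq> 0"
  shows "ldeg f = Suc (ldeg (D f))"
  using ldeg_neq_0[OF assms(2)] ldeg_Suc[OF D_mem[OF assms(1)]]
  by (intro ldeg_eqI) (simp_all add: funpow_swap1)

end

section \<open>Homogeneous locally nilpotent derivations\<close>

locale rational_grading = grading +
  assumes of_nat_unit: "n > 0 \<Longrightarrow> \<exists>u::'b. of_nat n * u = 1"
begin

lemma of_nat_neq_0: "n > 0 \<Longrightarrow> of_nat n \<noteq> (0::'b)"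
  using of_nat_unit[of n] by auto

text \<open>Values on homogeneous elements extend by summing over components, and nilpotence need
  only be checked on them, since a finite sum of elements killed by iterates is killed by a common
  iterate. The measure \<open>\<mu>\<close> is left free because in the upward case the degree
  function of the old derivation applies only to powers.\<close>

lemma HLND_nontrivialI:
  fixes \<mu> :: "'b \<Rightarrow> nat"
  assumes H: "add_subgroup H" and d: "d \<in> H"
    and mem: "\<And>i x. i \<in> H \<Longrightarrow> x \<in> B i \<Longrightarrow> \<delta> x \<in> B (i + d)"
    and add: "\<And>i x y. i \<in> H \<Longrightarrow> x \<in> B i \<Longrightarrow> y \<in> B i \<Longrightarrow> \<delta> (x + y) = \<delta> x + \<delta> y"
    and mult: "\<And>i j x y. i \<in> H \<Longrightarrow> j \<in> H \<Longrightarrow> x \<in> B i \<Longrightarrow> y \<in> B j \<Longrightarrow>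
      \<delta> (x * y) = \<delta> x * y + x * \<delta> y"
    and decreasing: "\<And>i x. i \<in> H \<Longrightarrow> x \<in> B i \<Longrightarrow> \<delta> x \<noteq> 0 \<Longrightarrow> \<mu> (\<delta> x) < \<mu> x"
    and nonzero: "i0 \<in> H" "x0 \<in> B i0" "\<delta> x0 \<noteq> 0"
  shows "HLND B H \<noteq> {\<lambda>x\<in>part B H. 0}"
proof -
  define E where "E b = (\<Sum>i | comp b i \<noteq> 0. \<delta> (comp b i))" for b
  define D where "D = restrict E (part B H)"
  have subring: "unital_subring (part B H)"
    by (rule unital_subring_part[OF H])
  note R = unital_subringD[OF subring]
  have \<delta>0: "\<delta> 0 = 0"
    using add[OF add_subgroup_zero[OF H], of 0 0] by (metis add_cancel_left_right add_0 zero_mem)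
  have comp_H: "comp b i \<in> B i \<and> (comp b i \<noteq> 0 \<longrightarrow> i \<in> H)" if "b \<in> part B H" for b i
    using that comp_mem by (simp add: part_iff)
  have E_sum: "E b = (\<Sum>i\<in>I. \<delta> (comp b i))" if "finite I" "{i. comp b i \<noteq> 0} \<subseteq> I" for b I
    unfolding E_def by (rule sum.mono_neutral_left) (use that \<delta>0 in auto)
  have E_hom: "E x = \<delta> x" if "x \<in> B i" for x i
    by (subst E_sum[of "{i}"]) (auto simp: comp_homogeneous[OF that] split: if_splits)
  have E_add: "E (x + y) = E x + E y" if "x \<in> part B H" "y \<in> part B H" for x y
  proof -
    let ?I = "{i. comp x i \<noteq> 0} \<union> {i. comp y i \<noteq> 0}"
    have fin: "finite ?I"
      by (simp add: finite_comp)
    have "E (x + y) = (\<Sum>i\<in>?I. \<delta> (comp x i + comp y i))"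
      by (subst E_sum[OF fin]) (auto simp: comp_add)
    also have "\<dots> = (\<Sum>i\<in>?I. \<delta> (comp x i) + \<delta> (comp y i))"
      by (rule sum.cong[OF refl]) (use that comp_H add in blast)
    also have "\<dots> = E x + E y"
      using E_sum[OF fin, of x] E_sum[OF fin, of y] by (simp add: sum.distrib)
    finally show ?thesis .
  qed
  have E_0: "E 0 = 0"
    using E_hom[of 0 0] \<delta>0 by simp
  have part_sum: "sum f I \<in> part B H" if "\<And>i. i \<in> I \<Longrightarrow> f i \<in> part B H" for f and I :: "'a set"
    by (rule add_subgroup_sum[OF R(1) that])
  have E_of_sum: "E (sum f I) = (\<Sum>i\<in>I. E (f i))"
    if "\<And>i. i \<in> I \<Longrightarrow> f i \<in> part B H" for f and I :: "'a set"
    using that by (induction I rule: infinite_finite_induct) (simp_all add: E_0 E_add part_sum)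
  have E_mem: "E b \<in> part B H" if "b \<in> part B H" for b
    unfolding E_def
  proof (rule part_sum)
    fix i assume "i \<in> {i. comp b i \<noteq> 0}"
    then have "i \<in> H"
      using comp_H[OF that] by auto
    then show "\<delta> (comp b i) \<in> part B H"
      using mem[OF _ comp_mem] add_subgroup_add[OF H _ d] homogeneous_part by blast
  qed
  have E_mult: "E (x * y) = E x * y + x * E y" if xy: "x \<in> part B H" "y \<in> part B H" for x y
  proof -
    let ?I = "{i. comp x i \<noteq> 0}" and ?J = "{i. comp y i \<noteq> 0}"
    have prod: "comp x i * comp y j \<in> part B H" if "i \<in> ?I" "j \<in> ?J" for i j
      using that comp_H[OF xy(1), of i] comp_H[OF xy(2), of j] homogeneous_part R(6) by blast
    have "E (x * y) = E (\<Sum>i\<in>?I. \<Sum>j\<in>?J. comp x i * comp y j)"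
      by (simp only: sum_product[symmetric] flip: sum_comp')
    also have "\<dots> = (\<Sum>i\<in>?I. \<Sum>j\<in>?J. E (comp x i * comp y j))"
    proof (subst E_of_sum)
      show "(\<Sum>j\<in>?J. comp x i * comp y j) \<in> part B H" if "i \<in> ?I" for i
        by (intro part_sum prod that)
      show "(\<Sum>i\<in>?I. E (\<Sum>j\<in>?J. comp x i * comp y j)) =
          (\<Sum>i\<in>?I. \<Sum>j\<in>?J. E (comp x i * comp y j))"
        by (intro sum.cong refl E_of_sum prod)
    qed
    also have "\<dots> = (\<Sum>i\<in>?I. \<Sum>j\<in>?J. \<delta> (comp x i) * comp y j + comp x i * \<delta> (comp y j))"
    proof (intro sum.cong refl)
      fix i j assume "i \<in> ?I" "j \<in> ?J"
      then show "E (comp x i * comp y j) = \<delta> (comp x i) * comp y j + comp x i * \<delta> (comp y j)"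
        using E_hom[OF mult_mem[OF comp_mem comp_mem], of x i y j] mult[OF _ _ comp_mem comp_mem]
          comp_H[OF xy(1), of i] comp_H[OF xy(2), of j] by auto
    qed
    also have "\<dots> = E x * (\<Sum>j\<in>?J. comp y j) + (\<Sum>i\<in>?I. comp x i) * E y"
      by (simp only: E_def sum.distrib sum_product)
    also have "\<dots> = E x * y + x * E y"
      by (simp only: flip: sum_comp')
    finally show ?thesis .
  qed
  have deriv: "derivation_on (part B H) D"
    unfolding derivation_on_def D_def using E_add E_mult E_mem R by auto
  interpret derivation "part B H" D
    by unfold_locales (rule subring deriv)+
  have D_hom: "D x = \<delta> x" if "i \<in> H" "x \<in> B i" for i x
    using that E_hom homogeneous_part by (simp add: D_def)
  have nilp_hom: "\<exists>n. (D ^^ n) x = 0" if "i \<in> H" "x \<in> B i" for i x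
    using that
  proof (induction "\<mu> x" arbitrary: i x rule: less_induct)
    case less
    show ?case
    proof (cases "\<delta> x = 0")
      case True
      then have "(D ^^ 1) x = 0"
        using D_hom[OF less.prems] by simp
      then show ?thesis by blast
    next
      case False
      then obtain n where "(D ^^ n) (\<delta> x) = 0"
        using less.hyps[OF decreasing[OF less.prems False]] mem[OF less.prems]
          add_subgroup_add[OF H less.prems(1) d] by blast
      then have "(D ^^ Suc n) x = 0"
        using D_hom[OF less.prems] by (simp add: funpow_swap1)
      then show ?thesis by blast
    qed
  qed
  have nilp_sum: "\<exists>n. (D ^^ n) (sum f I) = 0"
    if "\<And>i. i \<in> I \<Longrightarrow> f i \<in> part B H \<and> (\<exists>n. (D ^^ n) (f i) = 0)" for f and I :: "'a set"
    using that
  proof (induction I rule: infinite_finite_induct)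
    case (insert i I)
    then obtain m n where mn: "(D ^^ m) (f i) = 0" "(D ^^ n) (sum f I) = 0"
      by blast
    have "(D ^^ (m + n)) (f i + sum f I) = (D ^^ (m + n)) (f i) + (D ^^ (m + n)) (sum f I)"
      using insert.prems by (intro funpow_add_R part_sum) auto
    also have "\<dots> = 0"
      using funpow_eq_0_mono[OF mn(1), of "m + n"] funpow_eq_0_mono[OF mn(2), of "m + n"] by simp
    finally show ?case
      using insert.hyps by auto
  qed (auto intro: exI[of _ 0])
  have "locally_nilpotent_on (part B H) D"
    unfolding locally_nilpotent_on_def
  proof
    fix b assume b: "b \<in> part B H"
    have "\<exists>n. (D ^^ n) (\<Sum>i | comp b i \<noteq> 0. comp b i) = 0"
      using comp_H[OF b] homogeneous_part nilp_hom by (intro nilp_sum) blast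
    then obtain n where "(D ^^ n) b = 0"
      by (auto simp flip: sum_comp')
    then show "\<exists>n>0. (D ^^ n) b = 0"
      using funpow_eq_0_mono[of n b "Suc n"] by (intro exI[of _ "Suc n"]) auto
  qed
  moreover have "\<forall>i\<in>H. D ` B i \<subseteq> B (i + d)"
    using D_hom mem by auto
  ultimately have "D \<in> HLND B H"
    using deriv d by (auto simp: HLND_def)
  moreover have "D \<noteq> (\<lambda>x\<in>part B H. 0)"
  proof
    assume eq: "D = (\<lambda>x\<in>part B H. 0)"
    have "D x0 = 0"
      unfolding eq using homogeneous_part nonzero by simp
    then show False
      using D_hom nonzero by simp
  qed
  ultimately show ?thesis
    by blast
qed

text \<open>The zero derivation always belongs to \<open>HLND B H\<close>, so a set other than its
  singleton contains a nonzero one; by additivity that one is nonzero on some component.\<close>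

lemma XX_obtain:
  assumes "H \<in> XX B"
  obtains D d i x where "lnd (part B H) D" "d \<in> H" "\<And>j y. j \<in> H \<Longrightarrow> y \<in> B j \<Longrightarrow> D y \<in> B (j + d)"
    "i \<in> H" "x \<in> B i" "D x \<noteq> 0"
proof -
  have H: "add_subgroup H" and ne: "HLND B H \<noteq> {\<lambda>x\<in>part B H. 0}"
    using assms by (auto simp: XX_def TT_def)
  have subring: "unital_subring (part B H)"
    by (rule unital_subring_part[OF H])
  note R = unital_subringD[OF subring]
  have "locally_nilpotent_on (part B H) (\<lambda>x\<in>part B H. 0)"
    unfolding locally_nilpotent_on_def by (intro ballI exI[of _ 1]) simp
  moreover have "derivation_on (part B H) (\<lambda>x\<in>part B H. 0)"
    using R by (auto simp: derivation_on_def)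
  ultimately have "(\<lambda>x\<in>part B H. 0) \<in> HLND B H"
    unfolding HLND_def using add_subgroup_zero[OF H] homogeneous_part
    by (auto intro!: bexI[of _ 0])
  with ne obtain D where D: "D \<in> HLND B H" "D \<noteq> (\<lambda>x\<in>part B H. 0)"
    by blast
  then obtain d where d: "d \<in> H" "\<forall>i\<in>H. D ` B i \<subseteq> B (i + d)"
    and deriv: "derivation_on (part B H) D" and nilp: "locally_nilpotent_on (part B H) D"
    by (auto simp: HLND_def)
  interpret lnd "part B H" D
    using subring deriv nilp of_nat_neq_0 by unfold_locales auto
  have D_sum: "D (sum f I) = (\<Sum>i\<in>I. D (f i))"
    if "\<And>i. i \<in> I \<Longrightarrow> f i \<in> part B H" for f and I :: "'a set"
    using that
    by (induction I rule: infinite_finite_induct) (simp_all add: D_add add_subgroup_sum[OF R(1)])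
  have "D \<in> part B H \<rightarrow>\<^sub>E part B H"
    using deriv by (simp add: derivation_on_def)
  then have "D = (\<lambda>x\<in>part B H. D x)"
    by (simp add: PiE_restrict)
  then obtain b where b: "b \<in> part B H" "D b \<noteq> 0"
    using D(2) by (metis restrict_ext)
  have "\<exists>i. comp b i \<noteq> 0 \<and> D (comp b i) \<noteq> 0"
  proof (rule ccontr)
    assume no: "\<not> ?thesis"
    have "D b = D (\<Sum>i | comp b i \<noteq> 0. comp b i)"
      by (simp flip: sum_comp')
    also have "\<dots> = (\<Sum>i | comp b i \<noteq> 0. D (comp b i))"
    proof (rule D_sum)
      fix i assume "i \<in> {i. comp b i \<noteq> 0}"
      then have "i \<in> H"
        using b(1) by (simp add: part_iff)
      then show "comp b i \<in> part B H"
        by (rule homogeneous_part[OF _ comp_mem])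
    qed
    also have "\<dots> = 0"
      using no by (intro sum.neutral) blast
    finally show False
      using b by simp
  qed
  then obtain i where "i \<in> H" "D (comp b i) \<noteq> 0"
    using b by (auto simp: part_iff)
  then show thesis
    using that[of D d i "comp b i"] lnd_axioms d comp_mem by blast
qed

lemma add_subgroup_GG: "add_subgroup (GG B)"
  unfolding GG_def by (rule add_subgroup_group_closure)

lemma TT_I:
  assumes "add_subgroup H" "n > 0" "\<And>i. i \<in> GG B \<Longrightarrow> nmul n i \<in> H"
  shows "H \<in> TT B"
  using assms add_subgroup_nmul[OF add_subgroup_GG, of _ n]
  unfolding TT_def torsion_quotient_def nmul_def[symmetric] by blast

end

section \<open>Restriction to smaller subgroups\<close>

context rational_grading
begin

text \<open>With a homogeneous local slice \<open>x\<close> and \<open>a = D x\<close>, the derivation of \<open>B\<^sup>(\<^sup>H\<^sup>')\<close> is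
  \<open>\<gamma> D / x\<^bsup>e - 1\<^esup>\<close>, where \<open>e\<close> is the least positive integer such that some nonzero homogeneous
  element \<open>\<alpha>\<close> of the kernel of \<open>D\<close> has degree \<open>e d\<close> modulo \<open>H'\<close>. In the expansion in powers of
  \<open>x\<close> of an element of degree \<open>d\<close> modulo \<open>H'\<close> all exponents are at least \<open>e - 1\<close>; hence a power of
  \<open>a\<close>, which can be chosen uniformly as the ring is Noetherian, makes it divisible by
  \<open>x\<^bsup>e - 1\<^esup>\<close>.\<close>

lemma XX_mono:
  assumes noeth: "noetherian_on (UNIV :: 'b set)" and HX: "H \<in> XX B"
    and H': "H' \<in> TT B" "H' \<subseteq> H" and n: "n > 0" and nGG: "\<And>i. i \<in> GG B \<Longrightarrow> nmul n i \<in> H'"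
  shows "H' \<in> XX B"
proof -
  have subH: "add_subgroup H" and subH': "add_subgroup H'"
    using HX H' by (auto simp: XX_def TT_def)
  note addH = add_subgroup_add[OF subH] and nmulH = add_subgroup_nmul[OF subH]
  obtain D d i0 y where lnd: "lnd (part B H) D" and d: "d \<in> H"
    and D_hom: "\<And>j y. j \<in> H \<Longrightarrow> y \<in> B j \<Longrightarrow> D y \<in> B (j + d)"
    and y: "i0 \<in> H" "y \<in> B i0" "D y \<noteq> 0"
    using XX_obtain[OF HX] by metis
  interpret lnd "part B H" D
    by (rule lnd)
  have hom: "b \<in> part B H" if "i \<in> H" "b \<in> B i" for i b
    using that by (rule homogeneous_part)
  have funpow_hom: "(D ^^ k) b \<in> B (i + nmul k d)" if "i \<in> H" "b \<in> B i" for k i b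
  proof (induction k)
    case (Suc k)
    then show ?case
      using D_hom[OF addH[OF that(1) nmulH[OF d]] Suc.IH] by (simp add: algebra_simps)
  qed (use that in simp)
  \<comment> \<open>The last nonzero iterate of \<open>D\<close> on \<open>y\<close> lies in the
    kernel, so the iterate before it is a local slice. The subtraction is harmless:
    \<open>D y\<close> is nonzero, so \<open>ldeg y\<close> is positive.\<close>
  define x where "x = (D ^^ (ldeg y - 1)) y"
  define p where "p = i0 + nmul (ldeg y - 1) d"
  define a where "a = D x"
  define q where "q = p + d"
  have y_mem: "y \<in> part B H"
    using y hom by blast
  have "y \<noteq> 0"
    using y by auto
  have "ldeg y = Suc (ldeg y - 1)"
    using ldeg_D[OF y_mem y(3)] by simp
  then have a_eq: "a = (D ^^ ldeg y) y"
    unfolding a_def x_def by (metis comp_apply funpow.simps(2))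
  have a0: "a \<noteq> 0" and Da: "D a = 0"
    unfolding a_eq using ldeg_neq_0[OF \<open>y \<noteq> 0\<close>] ldeg_Suc[OF y_mem] by simp_all
  have pH: "p \<in> H" and qH: "q \<in> H"
    unfolding p_def q_def by (intro addH nmulH y d)+
  have xB: "x \<in> B p"
    unfolding x_def p_def by (rule funpow_hom[OF y(1,2)])
  have aB: "a \<in> B q"
    unfolding a_def q_def by (rule D_hom[OF pH xB])
  have xR: "x \<in> part B H" and aR: "a \<in> part B H"
    using hom pH xB qH aB by blast+
  have x0: "x \<noteq> 0"
    using a0 by (auto simp: a_def)
  have pG: "p \<in> GG B" and qG: "q \<in> GG B"
    using mem_GG xB x0 aB a0 by blast+
  have dG: "d \<in> GG B"
    using add_subgroup_diff[OF add_subgroup_GG qG pG] by (simp add: q_def)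
  define Q where "Q e \<longleftrightarrow> e > 0 \<and> (\<exists>j\<in>H. \<exists>\<beta>\<in>B j. \<beta> \<noteq> 0 \<and> D \<beta> = 0 \<and> j - nmul e d \<in> H')" for e
  define e where "e = (LEAST e. Q e)"
  \<comment> \<open>The witness is \<open>1\<close>, of degree zero, because \<open>nmul n d\<close>
    lies in \<open>H'\<close>.\<close>
  have "Q n"
    unfolding Q_def using n one_mem add_subgroup_zero[OF subH] add_subgroup_minus[OF subH' nGG[OF dG]]
    by (intro conjI bexI[of _ 0] bexI[of _ 1]) simp_all
  then have "Q e"
    unfolding e_def by (rule LeastI)
  then obtain j \<alpha> where e: "e > 0" and j: "j \<in> H" "j - nmul e d \<in> H'"
    and \<alpha>: "\<alpha> \<in> B j" "\<alpha> \<noteq> 0" "D \<alpha> = 0"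
    unfolding Q_def by blast
  have e_least: "e \<le> m" if "Q m" for m
    unfolding e_def using that by (rule Least_le)
  have divisible: "\<exists>M. x ^ (e - 1) dvd a ^ M * f"
    if "(D ^^ m) f = 0" "f \<in> B i" "i \<in> H" "i - d \<in> H'" for m f i
    using that
  proof (induction m arbitrary: f i)
    case 0
    then show ?case by simp
  next
    case (Suc m)
    define \<beta> where "\<beta> = (D ^^ m) f"
    have fR: "f \<in> part B H"
      using hom Suc.prems by blast
    have \<beta>B: "\<beta> \<in> B (i + nmul m d)" and iH: "i + nmul m d \<in> H"
      unfolding \<beta>_def using Suc.prems by (auto intro: funpow_hom addH nmulH d)
    have \<beta>R: "\<beta> \<in> part B H"
      using hom \<beta>B iH by blast
    have D\<beta>: "D \<beta> = 0"
      using Suc.prems by (simp add: \<beta>_def)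
    show ?case
    proof (cases "\<beta> = 0")
      case True
      then show ?thesis
        using Suc.IH[of f i] Suc.prems by (simp add: \<beta>_def)
    next
      case False
      \<comment> \<open>As \<open>f\<close> already has degree \<open>d\<close> modulo
        \<open>H'\<close>, its \<open>m\<close>-th derivative has degree (m + 1) d. This shift by
        one is why the denominator has exponent \<open>e - 1\<close>.\<close>
      have "i + nmul m d - nmul (Suc m) d = i - d"
        by simp
      then have "i + nmul m d - nmul (Suc m) d \<in> H'"
        using Suc.prems(4) by (simp only:)
      then have "Q (Suc m)"
        unfolding Q_def using iH \<beta>B False D\<beta>
        by (intro conjI bexI[of _ "i + nmul m d"] bexI[of _ \<beta>]) (simp_all del: nmul_Suc)
      then have "e - 1 \<le> m"
        using e_least by fastforce
      then have dvd_xm: "x ^ (e - 1) dvd x ^ m"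
        by (rule le_imp_power_dvd)
      \<comment> \<open>The multiples \<open>c * f\<close> and \<open>c' * x ^ m\<close> have the
        same \<open>m\<close>-th derivative. Using \<open>a ^ (n * m)\<close> instead of
        \<open>a ^ m\<close> leaves the degree unchanged modulo \<open>H'\<close>, so the induction
        hypothesis applies to the difference.\<close>
      define c where "c = of_nat (fact m) * a ^ (n * m)"
      define c' where "c' = a ^ ((n - 1) * m) * \<beta>"
      define f' where "f' = c * f - c' * x ^ m"
      have cR: "c \<in> part B H" and c'R: "c' \<in> part B H"
        unfolding c_def c'_def by (intro R R_power R_of_nat aR \<beta>R)+
      have Dc: "D c = 0" and Dc': "D c' = 0"
        unfolding c_def c'_def using D_kernel_power[OF aR Da] D\<beta>
          D_mult[OF R_of_nat R_power[OF aR]] D_mult[OF R_power[OF aR] \<beta>R]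
        by simp_all
      have nm: "n * m = (n - 1) * m + m"
        using n by (cases n) simp_all
      have "(D ^^ m) f' = (D ^^ m) (c * f) - (D ^^ m) (c' * x ^ m)"
        unfolding f'_def by (intro funpow_diff R(6) R_power cR c'R fR xR)
      also have "\<dots> = c * \<beta> - c' * (of_nat (fact m) * a ^ m)"
        using funpow_kernel_mult[OF cR Dc fR, of m] funpow_kernel_mult[OF c'R Dc' R_power[OF xR], of m m]
          funpow_local_slice[OF xR Da[unfolded a_def], of m] by (simp only: a_def \<beta>_def)
      also have "\<dots> = 0"
        unfolding c_def c'_def nm power_add by (simp only: mult_ac diff_self)
      finally have nil: "(D ^^ m) f' = 0" .
      define i' where "i' = i + nmul (n * m) q"
      have nq: "nmul (n * m) q \<in> H'"
        using add_subgroup_nmul[OF subH' nGG[OF qG], of m] by (simp add: mult.commute nmul_mult)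
      have i'H: "i' \<in> H"
        unfolding i'_def using nq H'(2) Suc.prems by (auto intro: addH)
      have i'd: "i' - d \<in> H'"
        using add_subgroup_add[OF subH' Suc.prems(4) nq] by (simp add: i'_def algebra_simps)
      have "c * f \<in> B i'"
        using of_nat_mult_mem[OF mult_mem[OF power_mem[OF aB] Suc.prems(2)], of "fact m" "n * m"]
        by (simp add: c_def i'_def mult.assoc add.commute)
      moreover have "c' * x ^ m \<in> B i'"
      proof -
        have "c' * x ^ m \<in> B (nmul ((n - 1) * m) q + (i + nmul m d) + nmul m p)"
          unfolding c'_def by (intro mult_mem power_mem aB \<beta>B xB)
        moreover have "nmul (n * m) q = nmul ((n - 1) * m) q + (nmul m p + nmul m d)"
          unfolding nm nmul_add_left by (simp add: q_def nmul_add_right)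
        ultimately show ?thesis
          by (simp add: i'_def algebra_simps)
      qed
      ultimately have "f' \<in> B i'"
        unfolding f'_def by (rule diff_mem)
      from Suc.IH[OF nil this i'H i'd] obtain M where M: "x ^ (e - 1) dvd a ^ M * f'"
        by blast
      obtain u where u: "of_nat (fact m) * u = (1::'b)"
        using of_nat_unit[of "fact m"] by auto
      have "a ^ (M + n * m) * f = (of_nat (fact m) * u) * (a ^ (M + n * m) * f)"
        using u by simp
      also have "\<dots> = u * (a ^ M * f' + a ^ M * c' * x ^ m)"
        by (simp add: f'_def c_def power_add algebra_simps)
      also have "x ^ (e - 1) dvd \<dots>"
        by (rule dvd_mult, rule dvd_add[OF M dvd_mult[OF dvd_xm]])
      finally show ?thesis by blast
    qed
  qed
  define I where "I k = {f. x ^ (e - 1) dvd a ^ k * f}" for k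
  have "ring_ideal (I k)" for k
    by (auto simp: I_def ring_ideal_iff distrib_left mult.left_commute[of _ "_ :: 'b"])
  moreover have "I k \<subseteq> I (Suc k)" for k
    by (auto simp: I_def mult.assoc)
  ultimately obtain k where k: "\<And>m. I m \<subseteq> I k"
    using noetherian_on_chain[OF noeth, of I] by blast
  \<comment> \<open>Modulo \<open>H'\<close>, \<open>\<alpha> ^ (n - 1)\<close> has degree -e d and
    cancels the degree e d of (a/x)^(e-1) D. The factor \<open>a ^ (n * k)\<close> has degree in
    \<open>H'\<close> and clears the denominator.\<close>
  define \<gamma> where "\<gamma> = \<alpha> ^ (n - 1) * a ^ (e - 1 + n * k)"
  have \<alpha>R: "\<alpha> \<in> part B H"
    using hom \<alpha> j by blast
  have \<gamma>0: "\<gamma> \<noteq> 0" and \<gamma>R: "\<gamma> \<in> part B H"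
    unfolding \<gamma>_def using \<alpha>(2) a0 by (simp, intro R R_power \<alpha>R aR)
  have D\<gamma>: "D \<gamma> = 0"
    using D_kernel_power[OF aR Da] D_kernel_power[OF \<alpha>R \<alpha>(3)] aR \<alpha>R
    by (simp add: \<gamma>_def D_mult R_power)
  have "\<exists>c. b \<in> B i \<longrightarrow> i \<in> H' \<longrightarrow> x ^ (e - 1) * c = \<gamma> * D b" for b i
  proof (cases "b \<in> B i \<and> i \<in> H'")
    case True
    then have b: "b \<in> B i" "i \<in> H"
      using H' by auto
    have "D b \<in> B (i + d)" "i + d \<in> H"
      using D_hom addH d b by auto
    moreover have "(D ^^ ldeg b) (D b) = 0"
      using ldeg_Suc[of b] hom b by (simp add: funpow_swap1)
    moreover have "i + d - d \<in> H'"
      using True by simp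
    ultimately obtain M where "x ^ (e - 1) dvd a ^ M * D b"
      using divisible by blast
    then have "x ^ (e - 1) dvd a ^ k * D b"
      using k by (auto simp: I_def)
    moreover have "k \<le> e - 1 + n * k"
      using n by (simp add: trans_le_add2)
    then have "a ^ k dvd \<gamma>"
      unfolding \<gamma>_def by (intro dvd_mult le_imp_power_dvd)
    ultimately have "x ^ (e - 1) dvd \<gamma> * D b"
      by (meson dvd_refl dvd_trans mult_dvd_mono)
    then show ?thesis
      by (auto elim: dvdE)
  qed auto
  then have "\<forall>b. \<exists>c. \<forall>i. b \<in> B i \<longrightarrow> i \<in> H' \<longrightarrow> x ^ (e - 1) * c = \<gamma> * D b"
    by metis
  then obtain \<delta> where \<delta>: "\<And>i b. i \<in> H' \<Longrightarrow> b \<in> B i \<Longrightarrow> x ^ (e - 1) * \<delta> b = \<gamma> * D b"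
    by metis
  define d' where "d' = nmul (n - 1) j + nmul (e - 1 + n * k) q + d - nmul (e - 1) p"
  have xe0: "x ^ (e - 1) \<noteq> 0"
    using x0 by simp
  have inR: "b \<in> part B H" if "i \<in> H'" "b \<in> B i" for i b
    using that H' hom by blast
  have "HLND B H' \<noteq> {\<lambda>x\<in>part B H'. 0}"
  proof (rule HLND_nontrivialI[OF subH'])
    have "nmul n j = j + nmul (n - 1) j" "nmul e d = d + nmul (e - 1) d"
      using nmul_Suc[of "n - 1" j] nmul_Suc[of "e - 1" d] n e by simp_all
    moreover have "nmul (e - 1 + n * k) q = nmul (e - 1) p + nmul (e - 1) d + nmul (n * k) q"
      by (simp add: nmul_add_left nmul_add_right q_def)
    ultimately have "d' = nmul n j + nmul (n * k) q - (j - nmul e d)"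
      by (simp add: d'_def algebra_simps)
    moreover have "nmul (n * k) q \<in> H'"
      using add_subgroup_nmul[OF subH' nGG[OF qG], of k] by (simp add: mult.commute nmul_mult)
    moreover have "nmul n j \<in> H'"
      using nGG mem_GG \<alpha> by blast
    ultimately show d': "d' \<in> H'"
      using j subH' by (simp add: add_subgroup_add add_subgroup_diff)
    show \<delta>B: "\<delta> b \<in> B (i + d')" if ib: "i \<in> H'" "b \<in> B i" for i b
    proof -
      have "\<gamma> * D b \<in> B (nmul (n - 1) j + nmul (e - 1 + n * k) q + (i + d))"
        unfolding \<gamma>_def using ib H' by (intro mult_mem power_mem \<alpha> aB D_hom) auto
      then have "x ^ (e - 1) * \<delta> b \<in> B (nmul (n - 1) j + nmul (e - 1 + n * k) q + (i + d))"
        using \<delta>[OF ib] by simp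
      from homogeneous_cancel'[OF power_mem[OF xB] xe0 this] show ?thesis
        by (simp add: d'_def algebra_simps)
    qed
    show "\<delta> (b + c) = \<delta> b + \<delta> c" if "i \<in> H'" "b \<in> B i" "c \<in> B i" for i b c
    proof -
      have "x ^ (e - 1) * \<delta> (b + c) = x ^ (e - 1) * (\<delta> b + \<delta> c)"
        using D_add[OF inR[OF that(1,2)] inR[OF that(1,3)]]
        by (simp only: distrib_left \<delta>[OF that(1,2)] \<delta>[OF that(1,3)]
            \<delta>[OF that(1) add_mem[OF that(2,3)]])
      then show ?thesis
        using xe0 mult_cancel_left by blast
    qed
    show "\<delta> (b * c) = \<delta> b * c + b * \<delta> c"
      if ij: "i \<in> H'" "j \<in> H'" "b \<in> B i" "c \<in> B j" for i j b c
    proof -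
      have "x ^ (e - 1) * \<delta> (b * c) = \<gamma> * D b * c + b * (\<gamma> * D c)"
        using \<delta>[OF add_subgroup_add[OF subH' ij(1,2)] mult_mem[OF ij(3,4)]]
          D_mult[OF inR[OF ij(1,3)] inR[OF ij(2,4)]] by (simp add: algebra_simps)
      also have "\<dots> = x ^ (e - 1) * (\<delta> b * c + b * \<delta> c)"
        unfolding \<delta>[OF ij(1,3), symmetric] \<delta>[OF ij(2,4), symmetric] by (simp add: algebra_simps)
      finally show ?thesis
        using xe0 mult_cancel_left by blast
    qed
    show "ldeg (\<delta> b) < ldeg b" if ib: "i \<in> H'" "b \<in> B i" and \<delta>b: "\<delta> b \<noteq> 0" for i b
    proof -
      have Db0: "D b \<noteq> 0"
        using \<delta>[OF ib] xe0 \<delta>b by auto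
      have \<delta>R: "\<delta> b \<in> part B H"
        using \<delta>B[OF ib] add_subgroup_add[OF subH' ib(1) d'] inR by blast
      have "ldeg (x ^ (e - 1) * \<delta> b) = ldeg (\<gamma> * D b)"
        using \<delta>[OF ib] by simp
      then have "ldeg (x ^ (e - 1)) + ldeg (\<delta> b) = ldeg \<gamma> + ldeg (D b)"
        using xe0 \<gamma>0 Db0 \<delta>b \<delta>R \<gamma>R D_mem[OF inR[OF ib]] R_power[OF xR]
        by (simp add: ldeg_mult)
      then show ?thesis
        using ldeg_kernel[OF D\<gamma> \<gamma>0] ldeg_D[OF inR[OF ib] Db0] by simp
    qed
    \<comment> \<open>The slice \<open>x\<close> may be missing from the smaller ring, but
      \<open>x ^ n\<close> belongs to it and is not in the kernel.\<close>
    show "nmul n p \<in> H'"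
      by (rule nGG[OF pG])
    show "x ^ n \<in> B (nmul n p)"
      by (rule power_mem[OF xB])
    have "D (x ^ n) \<noteq> 0"
      unfolding D_power_eq[OF xR n] using of_nat_neq_0[OF n] x0 a0 by (simp add: a_def)
    then show "\<delta> (x ^ n) \<noteq> 0"
      using \<delta>[OF nGG[OF pG] power_mem[OF xB]] \<gamma>0 by auto
  qed
  then show ?thesis
    using H' by (simp add: XX_def)
qed

end

section \<open>Extension to larger subgroups of normal domains\<close>

context rational_grading
begin

lemma add_subgroup_GG_bar: "add_subgroup (GG_bar B)"
proof (cases "(Spec1 :: 'b set set) = {}")
  case True
  then show ?thesis
    using add_subgroup_GG by (simp add: GG_bar_def)
next
  case False
  then show ?thesis
    using add_subgroup_group_closure[of "MM B P" for P]
    by (auto simp: GG_bar_def add_subgroup_def)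
qed

text \<open>The degrees not contained in \<open>P\<close> are closed under sums only, but modulo
  \<open>H\<close> the exponent \<open>n - 1\<close> on \<open>z2\<close> acts as a minus sign.
  Primeness keeps the product outside \<open>P\<close>.\<close>

lemma MM_closure_witness:
  assumes P: "prime_ideal P" and q: "q \<in> group_closure (MM B P)"
    and H: "add_subgroup H" and n: "n > 0" and nGG: "\<And>i. i \<in> GG B \<Longrightarrow> nmul n i \<in> H"
  shows "\<exists>j. \<exists>z\<in>B j. z \<notin> P \<and> j - q \<in> H"
  using q
proof induction
  case (base s)
  have "1 \<notin> P"
    using P by (auto simp: prime_ideal_def ring_ideal_iff) (metis UNIV_eq_I mult_1_right)
  then show ?case
    using base one_mem add_subgroup_zero[OF H] by (cases "s = 0") (auto simp: MM_def)
next
  case (diff s t)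
  then obtain j1 z1 j2 z2 where z: "z1 \<in> B j1" "z1 \<notin> P" "j1 - s \<in> H" "z2 \<in> B j2" "z2 \<notin> P" "j2 - t \<in> H"
    by blast
  have "0 \<in> P" and prime: "\<And>x y. x * y \<in> P \<Longrightarrow> x \<in> P \<or> y \<in> P" "1 \<notin> P"
    using P by (auto simp: prime_ideal_def ring_ideal_iff) (metis UNIV_eq_I mult_1_right)
  then have "j2 \<in> GG B"
    using z mem_GG by blast
  then have j2: "nmul n j2 \<in> H"
    by (rule nGG)
  have "z2 ^ k \<notin> P" for k
    using prime z by (induction k) auto
  then have "z1 * z2 ^ (n - 1) \<notin> P"
    using prime z by blast
  moreover have "z1 * z2 ^ (n - 1) \<in> B (j1 + nmul (n - 1) j2)"
    by (intro mult_mem power_mem z)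
  moreover have "nmul n j2 = j2 + nmul (n - 1) j2"
    using nmul_Suc[of "n - 1" j2] n by simp
  then have eq: "j1 + nmul (n - 1) j2 - (s - t) = (j1 - s) + nmul n j2 - (j2 - t)"
    by simp
  have "j1 + nmul (n - 1) j2 - (s - t) \<in> H"
    unfolding eq by (intro add_subgroup_add add_subgroup_diff H z j2)
  ultimately show ?case
    by blast
qed

text \<open>On a homogeneous element \<open>b\<close> of the larger ring, the extension \<open>\<delta>\<close> of \<open>D\<close> is
  \<open>D (b ^ n) / (n b ^ (n - 1))\<close>. For a prime \<open>P\<close> of height one, a homogeneous \<open>z \<notin> P\<close> with
  \<open>z b\<close> in the smaller ring shows that this fraction lies in the localization at \<open>P\<close>.\<close>

lemma XX_extend:
  assumes noeth: "noetherian_on (UNIV :: 'b set)" and normal: "normal_domain TYPE('b)"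
    and HX: "H \<in> XX B" and n: "n > 0" and nGG: "\<And>i. i \<in> GG B \<Longrightarrow> nmul n i \<in> H"
  shows "{h + q | h q. h \<in> H \<and> q \<in> GG_bar B} \<in> XX B"
proof -
  define H' where "H' = {h + q | h q. h \<in> H \<and> q \<in> GG_bar B}"
  have H: "add_subgroup H"
    using HX by (auto simp: XX_def TT_def)
  have H'I: "h + q \<in> H'" if "h \<in> H" "q \<in> GG_bar B" for h q
    using that by (auto simp: H'_def)
  have HH': "H \<subseteq> H'"
    using H'I[OF _ add_subgroup_zero[OF add_subgroup_GG_bar]] by auto
  have H': "add_subgroup H'"
    unfolding add_subgroup_def
  proof (intro conjI ballI)
    show "0 \<in> H'"
      using add_subgroup_zero[OF H] HH' by blast
  next
    fix x y assume "x \<in> H'" "y \<in> H'"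
    then obtain h q h' q' where xy: "h \<in> H" "q \<in> GG_bar B" "h' \<in> H" "q' \<in> GG_bar B"
      "x = h + q" "y = h' + q'"
      by (auto simp: H'_def)
    then have "(h + h') + (q + q') \<in> H'"
      by (intro H'I add_subgroup_add[OF H] add_subgroup_add[OF add_subgroup_GG_bar])
    then show "x + y \<in> H'"
      using xy by (simp add: algebra_simps)
  next
    fix x assume "x \<in> H'"
    then obtain h q where x: "h \<in> H" "q \<in> GG_bar B" "x = h + q"
      by (auto simp: H'_def)
    then have "- h + - q \<in> H'"
      by (intro H'I add_subgroup_minus[OF H] add_subgroup_minus[OF add_subgroup_GG_bar])
    then show "- x \<in> H'"
      using x by simp
  qed
  obtain D d i0 y where lnd: "lnd (part B H) D" and d: "d \<in> H"
    and D_hom: "\<And>j y. j \<in> H \<Longrightarrow> y \<in> B j \<Longrightarrow> D y \<in> B (j + d)"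
    and y: "i0 \<in> H" "y \<in> B i0" "D y \<noteq> 0"
    using XX_obtain[OF HX] by metis
  interpret lnd "part B H" D
    by (rule lnd)
  have hom: "b \<in> part B H" if "i \<in> H" "b \<in> B i" for i b
    using that by (rule homogeneous_part)
  define m where "m = n - 1"
  have nm: "n = Suc m"
    using n by (simp add: m_def)
  note n0 = of_nat_neq_0[OF n]
  have npow: "nmul n i \<in> H" if "b \<in> B i" "b \<noteq> 0" for i b
    using nGG mem_GG that by blast
  have powR: "b ^ n \<in> part B H" if "b \<in> B i" for i b
  proof (cases "b = 0")
    case True
    then show ?thesis using n R(3) by (simp add: zero_power)
  next
    case False
    show ?thesis
      by (rule hom[OF npow[OF that False] power_mem[OF that]])
  qed
  \<comment> \<open>Both sides compute D((z b)^n), once from \<open>z * b\<close> and once from the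
    two \<open>n\<close>-th powers, so neither \<open>z\<close> nor \<open>b\<close> has to lie in
    the domain of \<open>D\<close>.\<close>
  have key: "of_nat n * (z * b) ^ m * D (z * b) = D (z ^ n) * b ^ n + z ^ n * D (b ^ n)"
    if "z \<in> B j" "b \<in> B i" "j + i \<in> H" for z b i j
  proof -
    have "z * b \<in> part B H"
      using hom mult_mem that by blast
    then have "of_nat n * (z * b) ^ m * D (z * b) = D (z ^ n * b ^ n)"
      using D_power_eq[OF _ n, of "z * b"] by (simp add: m_def power_mult_distrib)
    also have "\<dots> = D (z ^ n) * b ^ n + z ^ n * D (b ^ n)"
      by (rule D_mult[OF powR[OF that(1)] powR[OF that(2)]])
    finally show ?thesis .
  qed
  obtain u where u: "of_nat n * u = (1::'b)"
    using of_nat_unit[OF n] by blast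
  have "of_nat n * b ^ m dvd D (b ^ n)" if b: "b \<in> B i" "i \<in> H'" "b \<noteq> 0" for b i
  proof (rule normal_dvd_of_Spec1[OF noeth normal])
    show "of_nat n * b ^ m \<noteq> 0"
      using n0 b by simp
    fix P :: "'b set"
    assume P: "P \<in> Spec1"
    then have prime: "prime_ideal P"
      by (simp add: Spec1_def)
    obtain h q where hq: "h \<in> H" "q \<in> GG_bar B" "i = h + q"
      using b by (auto simp: H'_def)
    have "q \<in> group_closure (MM B P)"
      using hq P by (auto simp: GG_bar_def split: if_splits)
    \<comment> \<open>With this sign, multiplication by \<open>z\<close> moves the degree of
      \<open>b\<close> into \<open>H\<close>.\<close>
    then have "- q \<in> group_closure (MM B P)"
      by simp
    from MM_closure_witness[OF prime this H n nGG]
    obtain j z where z: "z \<in> B j" "z \<notin> P" "j - - q \<in> H"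
      by blast
    have "j + i \<in> H"
      using add_subgroup_add[OF H z(3) hq(1)] by (simp add: hq algebra_simps)
    from key[OF z(1) b(1) this]
    have "z ^ n * D (b ^ n) = of_nat n * (z * b) ^ m * D (z * b) - (of_nat n * u) * (D (z ^ n) * b ^ n)"
      using u by (simp add: algebra_simps)
    also have "\<dots> = of_nat n * b ^ m * (z ^ m * D (z * b) - u * D (z ^ n) * b)"
      by (simp add: nm power_mult_distrib algebra_simps)
    finally have "of_nat n * b ^ m dvd z ^ n * D (b ^ n)"
      by simp
    moreover have "z ^ k \<notin> P" for k
    proof (induction k)
      case 0
      then show ?case
        using prime by (auto simp: prime_ideal_def ring_ideal_iff) (metis UNIV_eq_I mult_1_right)
    next
      case (Suc k)
      then show ?case
        using prime z by (auto simp: prime_ideal_def)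
    qed
    ultimately show "\<exists>z. z \<notin> P \<and> of_nat n * b ^ m dvd z * D (b ^ n)"
      by blast
  qed
  \<comment> \<open>For \<open>n > 1\<close> the equation is vacuous at zero, so the value there is
    prescribed.\<close>
  then have "\<exists>c. of_nat n * b ^ m * c = D (b ^ n) \<and> (b = 0 \<longrightarrow> c = 0)"
    if "b \<in> B i" "i \<in> H'" for b i
    using that by (cases "b = 0") (simp add: nm, metis dvdE)
  then have "\<forall>b. \<exists>c. \<forall>i. b \<in> B i \<longrightarrow> i \<in> H' \<longrightarrow> of_nat n * b ^ m * c = D (b ^ n) \<and> (b = 0 \<longrightarrow> c = 0)"
    by metis
  then obtain \<delta> where \<delta>': "\<And>b i. b \<in> B i \<longrightarrow> i \<in> H' \<longrightarrow>
      of_nat n * b ^ m * \<delta> b = D (b ^ n) \<and> (b = 0 \<longrightarrow> \<delta> b = 0)"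
    by metis
  have \<delta>: "of_nat n * b ^ m * \<delta> b = D (b ^ n)" if "i \<in> H'" "b \<in> B i" for i b
    using \<delta>' that by blast
  have \<delta>0: "\<delta> 0 = 0"
    using \<delta>'[of 0 0] add_subgroup_zero[OF H'] by simp
  have "HLND B H' \<noteq> {\<lambda>x\<in>part B H'. 0}"
  proof (rule HLND_nontrivialI[OF H'])
    show d': "d \<in> H'"
      using d HH' by blast
    show \<delta>B: "\<delta> b \<in> B (i + d)" if ib: "i \<in> H'" "b \<in> B i" for i b
    proof (cases "b = 0")
      case True
      then show ?thesis by (simp add: \<delta>0)
    next
      case False
      have "of_nat n * b ^ m * \<delta> b \<in> B (nmul n i + d)"
        unfolding \<delta>[OF ib] using npow[OF ib(2) False] by (intro D_hom power_mem ib)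
      moreover have "of_nat n * b ^ m \<in> B (nmul m i)"
        by (intro of_nat_mult_mem power_mem ib)
      moreover have "of_nat n * b ^ m \<noteq> 0"
        using n0 False by simp
      ultimately have "\<delta> b \<in> B (nmul n i + d - nmul m i)"
        using homogeneous_cancel' by blast
      then show ?thesis
        by (simp add: nm algebra_simps)
    qed
    show "\<delta> (b + c) = \<delta> b + \<delta> c" if bc: "i \<in> H'" "b \<in> B i" "c \<in> B i" for i b c
    proof (cases "b = 0")
      case True
      then show ?thesis by (simp add: \<delta>0)
    next
      case False
      \<comment> \<open>Multiplication by this \<open>z\<close> moves all of \<open>B i\<close> into
        the domain of \<open>D\<close>. There \<open>\<delta>\<close> is given, up to the fixed
        nonzero factor \<open>of_nat n * z ^ n\<close>, by the expression \<open>rel\<close>, which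
        is additive in \<open>x\<close>.\<close>
      define z where "z = b ^ m"
      have z: "z \<in> B (nmul m i)" "z \<noteq> 0"
        using power_mem bc False by (auto simp: z_def)
      have zi: "nmul m i + i \<in> H"
        using npow[OF bc(2) False] by (simp add: nm add.commute)
      have rel: "of_nat n * z ^ n * \<delta> x = of_nat n * z ^ m * D (z * x) - D (z ^ n) * x"
        if x: "x \<in> B i" for x
      proof (cases "x = 0")
        case True
        then show ?thesis by (simp add: \<delta>0)
      next
        case False
        have "of_nat n * (z * x) ^ m * D (z * x) = D (z ^ n) * x ^ n + z ^ n * (of_nat n * x ^ m * \<delta> x)"
          unfolding \<delta>[OF bc(1) x] by (rule key[OF z(1) x zi])
        then have "x ^ m * (of_nat n * z ^ m * D (z * x)) =
            x ^ m * (D (z ^ n) * x + of_nat n * z ^ n * \<delta> x)"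
          by (simp add: nm power_mult_distrib algebra_simps)
        then have "of_nat n * z ^ m * D (z * x) = D (z ^ n) * x + of_nat n * z ^ n * \<delta> x"
          using False by (simp only: mult_cancel_left power_not_zero) simp
        then show ?thesis
          by (simp only: add_diff_cancel_left')
      qed
      have zR: "z * x \<in> part B H" if "x \<in> B i" for x
        using hom[OF zi mult_mem[OF z(1) that]] .
      have "of_nat n * z ^ n * \<delta> (b + c) = of_nat n * z ^ n * (\<delta> b + \<delta> c)"
        unfolding distrib_left rel[OF bc(2)] rel[OF bc(3)] rel[OF add_mem[OF bc(2,3)]]
          D_add[OF zR[OF bc(2)] zR[OF bc(3)]] by (simp add: algebra_simps)
      then show ?thesis
        using n0 z by simp
    qed
    show "\<delta> (b * c) = \<delta> b * c + b * \<delta> c"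
      if bc: "i \<in> H'" "j \<in> H'" "b \<in> B i" "c \<in> B j" for i j b c
    proof (cases "b = 0 \<or> c = 0")
      case True
      then show ?thesis by (auto simp: \<delta>0)
    next
      case False
      have "of_nat n * (b * c) ^ m * \<delta> (b * c) = D (b ^ n * c ^ n)"
        using \<delta>[OF add_subgroup_add[OF H' bc(1,2)] mult_mem[OF bc(3,4)]]
        by (simp add: power_mult_distrib)
      also have "\<dots> = D (b ^ n) * c ^ n + b ^ n * D (c ^ n)"
        by (rule D_mult[OF powR[OF bc(3)] powR[OF bc(4)]])
      also have "\<dots> = of_nat n * (b * c) ^ m * (\<delta> b * c + b * \<delta> c)"
        unfolding \<delta>[OF bc(1,3), symmetric] \<delta>[OF bc(2,4), symmetric]
        by (simp add: nm power_mult_distrib algebra_simps)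
      finally show ?thesis
        using n0 False by simp
    qed
    \<comment> \<open>The elements \<open>b\<close> and \<open>\<delta> b\<close> may lie outside
      the domain of \<open>D\<close>, so their \<open>n\<close>-th powers are measured. With L =
      \<open>ldeg (b ^ n)\<close>, the \<open>n\<close>-th power of the defining equation gives n (L
      - 1) = (n - 1) L + \<open>ldeg (\<delta> b ^ n)\<close>, a drop by \<open>n\<close>.\<close>
    show "ldeg (\<delta> b ^ n) < ldeg (b ^ n)"
      if ib: "i \<in> H'" "b \<in> B i" and \<delta>b: "\<delta> b \<noteq> 0" for i b
    proof -
      have b0: "b \<noteq> 0"
        using \<delta>b \<delta>0 by auto
      have bR: "b ^ n \<in> part B H" and \<delta>R: "\<delta> b ^ n \<in> part B H"
        using powR ib \<delta>B by blast+
      have Db0: "D (b ^ n) \<noteq> 0"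
        using \<delta>[OF ib] n0 b0 \<delta>b by auto
      have "D (b ^ n) ^ n = of_nat (n ^ n) * ((b ^ n) ^ m * \<delta> b ^ n)"
        unfolding \<delta>[OF ib, symmetric] by (simp add: power_mult_distrib mult_ac flip: power_mult)
      then have "ldeg (D (b ^ n) ^ n) = ldeg (of_nat (n ^ n) * ((b ^ n) ^ m * \<delta> b ^ n))"
        by (simp only:)
      also have "\<dots> = ldeg ((b ^ n) ^ m * \<delta> b ^ n)"
        using b0 \<delta>b n by (intro ldeg_of_nat_mult R R_power bR \<delta>R) auto
      also have "\<dots> = ldeg ((b ^ n) ^ m) + ldeg (\<delta> b ^ n)"
        using b0 \<delta>b by (intro ldeg_mult R_power bR \<delta>R) auto
      finally have "n * ldeg (D (b ^ n)) = m * ldeg (b ^ n) + ldeg (\<delta> b ^ n)"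
        using ldeg_power[OF bR, of m] ldeg_power[OF D_mem[OF bR] Db0, of n] b0 by simp
      then show ?thesis
        unfolding ldeg_D[OF bR Db0] by (simp add: nm)
    qed
    show "i0 \<in> H'" "y \<in> B i0"
      using y HH' by auto
    have "of_nat n * y ^ m * \<delta> y = of_nat n * y ^ m * D y"
      using \<delta>[of i0 y] y HH' D_power_eq[OF hom[OF y(1,2)] n] by (auto simp: m_def)
    moreover have "y \<noteq> 0"
      using y by auto
    ultimately show "\<delta> y \<noteq> 0"
      using y n0 by simp
  qed
  moreover have "H' \<in> TT B"
    using TT_I[OF H' n] nGG HH' by blast
  ultimately show ?thesis
    by (simp add: XX_def H'_def)
qed

end

section \<open>Existence of maximal elements, and both claims from the two transports\<close>

theorem theorem6p1:
  fixes \<iota> :: "'k::field_char_0 \<Rightarrow> 'b::idom"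
    and B :: "'g::ab_group_add \<Rightarrow> 'b set"
  assumes "affine_domain \<iota>"
    and "fg_group TYPE('g)"
    and "graded_over \<iota> B"
  shows "XX B = (\<Union>H\<in>maximal_XX B. TT_below B H) \<and>
    (normal_domain TYPE('b) \<longrightarrow> (\<forall>H\<in>maximal_XX B. GG_bar B \<subseteq> H))"
proof -
  have \<iota>: "structure_map \<iota>" and fg: "fg_algebra \<iota>" and graded: "graded_ring B" "range \<iota> \<subseteq> B 0"
    using assms by (auto simp: affine_domain_def graded_over_def)
  note noeth = noetherian_on_affine[OF \<iota> fg]
  have \<iota>0: "\<iota> 0 = 0"
    using structure_mapD(2)[OF \<iota>, of 0 0] by (metis add_cancel_left_right add_0)
  have \<iota>_nat: "\<iota> (of_nat n) = of_nat n" for n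
    by (induction n) (simp_all add: \<iota>0 structure_mapD[OF \<iota>])
  interpret rational_grading B
  proof
    show "graded_ring B" by fact
    show "1 \<in> B 0"
      using graded structure_mapD(1)[OF \<iota>] by (metis range_subsetD)
    show "\<exists>u::'b. of_nat n * u = 1" if "n > 0" for n
    proof
      have "of_nat n * \<iota> (1 / of_nat n) = \<iota> (of_nat n * (1 / of_nat n))"
        by (simp only: structure_mapD[OF \<iota>] \<iota>_nat)
      also have "\<dots> = 1"
        using that structure_mapD(1)[OF \<iota>] by simp
      finally show "of_nat n * \<iota> (1 / of_nat n) = 1" .
    qed
  qed
  have exponent: "\<exists>n>0. \<forall>i\<in>GG B. nmul n i \<in> H" if "H \<in> TT B" for H
    using that torsion_quotient_exponent[OF assms(2)] by (auto simp: TT_def)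
  have XT: "H \<in> TT B" if "H \<in> XX B" for H
    using that by (simp add: XX_def)
  have maximal: "\<exists>M\<in>maximal_XX B. H \<subseteq> M" if "H \<in> XX B" for H
  proof -
    have "\<exists>M\<in>XX B. H \<subseteq> M \<and> (\<forall>Y\<in>XX B. M \<subseteq> Y \<longrightarrow> Y = M)"
      using that
    proof (rule maximal_above)
      fix C :: "nat \<Rightarrow> 'g set"
      assume C: "\<And>k. C k \<in> XX B" "\<And>k. C k \<subseteq> C (Suc k)"
      have "add_subgroup (C k)" for k
        using C(1)[of k] by (simp add: XX_def TT_def)
      then have "\<forall>k. add_subgroup (C k) \<and> C k \<subseteq> UNIV \<and> C k \<subseteq> C (Suc k)"
        using C(2) by simp
      then have "\<exists>n. \<forall>m\<ge>n. C m = C n"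
        by (rule acc_subgroups_fg[OF assms(2), unfolded acc_subgroups_def, THEN spec, THEN mp])
      then show "\<exists>k. C (Suc k) = C k"
        by (meson le_SucI order_refl)
    qed
    then show ?thesis
      by (auto simp: maximal_XX_def)
  qed
  have "XX B = (\<Union>H\<in>maximal_XX B. TT_below B H)"
  proof (intro equalityI subsetI)
    fix H assume "H \<in> XX B"
    then show "H \<in> (\<Union>H\<in>maximal_XX B. TT_below B H)"
      using maximal XT by (auto simp: TT_below_def)
  next
    fix H' assume "H' \<in> (\<Union>H\<in>maximal_XX B. TT_below B H)"
    then obtain H where "H \<in> XX B" "H' \<in> TT B" "H' \<subseteq> H"
      by (auto simp: TT_below_def maximal_XX_def)
    then show "H' \<in> XX B"
      using exponent[of H'] XX_mono[OF noeth] by blast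
  qed
  moreover have "GG_bar B \<subseteq> H" if normal: "normal_domain TYPE('b)" and H: "H \<in> maximal_XX B" for H
  proof -
    have HX: "H \<in> XX B"
      using H by (simp add: maximal_XX_def)
    let ?H' = "{h + q | h q. h \<in> H \<and> q \<in> GG_bar B}"
    have "?H' \<in> XX B"
      using exponent[OF XT[OF HX]] XX_extend[OF noeth normal HX] by blast
    moreover have "H \<subseteq> ?H'"
      using add_subgroup_zero[OF add_subgroup_GG_bar] by force
    ultimately have "?H' = H"
      using H by (auto simp: maximal_XX_def)
    moreover have "GG_bar B \<subseteq> ?H'"
      using HX add_subgroup_zero[of H] by (force simp: XX_def TT_def)
    ultimately show ?thesis
      by simp
  qed
  ultimately show ?thesis
    by blast
qed

end
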